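(* Every function $f\in\mathcal{S}^0_H(\mathcal{S})$ satisfies the inequalities $$\frac16\left[1-\left(\frac{1-r}{1+r}\right)^3\right]\le|f(z)|\le\frac16\left[\left(\frac{1+r}{1-r}\right)^3-1\right],\qquad r=|z|<1.$$ In particular, the range $f(\mathbb{D})$ of each function $f\in\mathcal{S}^0_H(\mathcal{S})$ contains the disk $|w|<\frac16$. The inequalities $\frac16\left[1-\left(\frac{1-r}{1+r}\right)^3\right]\le|f(z)|$ and $|f(z)|\le\frac16\left[\left(\frac{1+r}{1-r}\right)^3-1\right]$ are sharp, and equality is attained for the harmonic Koebe function $$K(z)=\frac{z-\frac12z^2+\frac16z^3}{(1-z)^3}+\overline{\left(\frac{\frac12z^2+\frac16z^3}{(1-z)^3}\right)}$$ and its rotations.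
   Context: $\mathbb{D}=\{z\in\mathbb{C}:|z|<1\}$. $\mathcal{H}$ is the class of complex-valued harmonic functions $f=h+\overline{g}$ in $\mathbb{D}$ with $h,g$ analytic in $\mathbb{D}$, $h(0)=g(0)=0$, $h'(0)=1$. Such an $f$ is (locally univalent and) sense-preserving if its Jacobian $J_f(z)=|h'(z)|^2-|g'(z)|^2$ is positive for all $z\in\mathbb{D}$. $\mathcal{S}_H$ is the class of all sense-preserving univalent (injective) $f\in\mathcal{H}$, and $\mathcal{S}^0_H$ is the class of $f\in\mathcal{S}_H$ with $f_{\overline{z}}(0)=0$ (i.e. $g'(0)=0$). $\mathcal{S}$ is the class of analytic univalent functions $\varphi$ on $\mathbb{D}$ with $\varphi(0)=0$, $\varphi'(0)=1$. Define $$\mathcal{S}^0_H(\mathcal{S})=\{h+\overline{g}\in\mathcal{S}^0_H:\ h+e^{i\theta}g\in\mathcal{S}\text{ for some }\theta\in\mathbb{R}\}.$$ The rotations of $K$ are the functions $z\mapsto e^{-i\alpha}K(e^{i\alpha}z)$, $\alpha\in\mathbb{R}$. *)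

theory Defs
  imports "HOL-Complex_Analysis.Complex_Analysis"
begin

abbreviation unit_disk :: "complex set" where
  "unit_disk \<equiv> ball 0 1"

text \<open>
  Functions on the disk are total functions on \<^typ>\<open>complex\<close>; nothing is required of the values
  outside \<^const>\<open>unit_disk\<close>. The normalization \<open>h 0 = g 0 = 0\<close> makes the pair \<open>(h, g)\<close> unique on
  the disk, so that the existential quantifiers over \<open>h\<close> and \<open>g\<close> below do not depend on a choice.
\<close>

definition harmonic_decomp :: "(complex \<Rightarrow> complex) \<Rightarrow> (complex \<Rightarrow> complex) \<Rightarrow> (complex \<Rightarrow> complex) \<Rightarrow> bool"
  where
  "harmonic_decomp f h g \<longleftrightarrow>
     h holomorphic_on unit_disk \<and> g holomorphic_on unit_disk \<and>
     h 0 = 0 \<and> g 0 = 0 \<and> deriv h 0 = 1 \<and>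
     (\<forall>z\<in>unit_disk. f z = h z + cnj (g z))"

definition class_H :: "(complex \<Rightarrow> complex) set" where
  "class_H = {f. \<exists>h g. harmonic_decomp f h g}"

definition decomp_jacobian :: "(complex \<Rightarrow> complex) \<Rightarrow> (complex \<Rightarrow> complex) \<Rightarrow> complex \<Rightarrow> real" where
  "decomp_jacobian h g z = (norm (deriv h z))\<^sup>2 - (norm (deriv g z))\<^sup>2"

definition sense_preserving :: "(complex \<Rightarrow> complex) \<Rightarrow> bool" where
  "sense_preserving f \<longleftrightarrow>
     (\<exists>h g. harmonic_decomp f h g \<and> (\<forall>z\<in>unit_disk. decomp_jacobian h g z > 0))"

definition class_SH :: "(complex \<Rightarrow> complex) set" where
  "class_SH = {f \<in> class_H. sense_preserving f \<and> inj_on f unit_disk}"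

text \<open>For \<open>f = h + cnj g\<close> the derivative of \<open>f\<close> with respect to the conjugate variable is
  \<open>cnj (deriv g z)\<close>, so that its vanishing at \<open>0\<close> means \<open>deriv g 0 = 0\<close>.\<close>

definition class_SH0 :: "(complex \<Rightarrow> complex) set" where
  "class_SH0 = {f \<in> class_SH. \<exists>h g. harmonic_decomp f h g \<and> deriv g 0 = 0}"

definition class_S :: "(complex \<Rightarrow> complex) set" where
  "class_S = {\<phi>. \<phi> holomorphic_on unit_disk \<and> inj_on \<phi> unit_disk \<and> \<phi> 0 = 0 \<and> deriv \<phi> 0 = 1}"

definition class_SH0_S :: "(complex \<Rightarrow> complex) set" where
  "class_SH0_S =
     {f \<in> class_SH0. \<exists>h g. harmonic_decomp f h g \<and>
        (\<exists>\<theta>::real. (\<lambda>z. h z + exp (\<i> * of_real \<theta>) * g z) \<in> class_S)}"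

definition harmonic_koebe :: "complex \<Rightarrow> complex" where
  "harmonic_koebe z =
     (z - 1/2 * z^2 + 1/6 * z^3) / (1 - z)^3 + cnj ((1/2 * z^2 + 1/6 * z^3) / (1 - z)^3)"

definition rotation :: "real \<Rightarrow> (complex \<Rightarrow> complex) \<Rightarrow> complex \<Rightarrow> complex" where
  "rotation \<alpha> F z = exp (- (\<i> * of_real \<alpha>)) * F (exp (\<i> * of_real \<alpha>) * z)"

end

theory Submission imports Defs begin

text \<open>
  Let \<open>\<phi> = h + e\<^sup>i\<^sup>\<theta> g\<close> be the shear of \<open>f = h + cnj g\<close> in \<open>class_S\<close> and let \<open>\<omega> = g'/h'\<close>. The Schwarz lemma
  gives \<open>\<bar>\<omega>(z)\<bar> \<le> \<bar>z\<bar> = r\<close>, and Koebe's distortion theorem bounds \<open>\<phi>' = h' (1 + e\<^sup>i\<^sup>\<theta> \<omega>)\<close>, so that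
  \<open>(1-r)\<^sup>2/(1+r)\<^sup>4 \<le> \<bar>h'\<bar> - \<bar>g'\<bar>\<close> and \<open>\<bar>h'\<bar> + \<bar>g'\<bar> \<le> (1+r)\<^sup>2/(1-r)\<^sup>4\<close>. Integrating the upper bound along a radius,
  and the lower bound along the preimage of a segment ending at a point of smallest modulus of the
  image of a circle, gives the growth estimates. The distortion theorem follows from
  \<open>\<bar>\<phi>''(0)\<bar> \<le> 4\<close>, which is the area theorem applied to \<open>1 / \<surd>\<phi>(z\<^sup>2)\<close>. The area theorem is obtained by
  comparing the area of the image of an annulus, computed in logarithmic coordinates, with the area
  enclosed by the image of its small inner circle.
\<close>

subsection \<open>Area of the image of a planar map\<close>

text \<open>Passing between |h'| - |g'| and |h'| + |g'| costs a factor at most (1+r)/(1-r), which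
  raises both exponents in Koebe's distortion bounds by one. The integral of (1-t)^2/(1+t)^4 over
  [0,1) is 1/6, hence the radius of the covered disk. In the area theorem both areas are of size
  pi/s^2 for the inner radius s, and they must be compared up to an error vanishing with s. A round
  disk around the image of the inner circle would have radius about 1/s + |\<beta>| s, whose square
  exceeds 1/s^2 by about 2|\<beta>|; in the limit only |\<beta>|^2 - 2|\<beta>| - 1 <= 0 would
  follow. A real-linear map that makes the nearly elliptic image round removes this error. In the
  lower growth estimate, |h'| - |g'| bounds the length of an image curve from below, not the modulus
  of its endpoint. The two agree only for a segment issuing from 0, so the curve has to be chosen in
  the image and pulled back; smallest modulus of the endpoint keeps the segment inside the
  image.\<close>

lemma integral_real2_eq_prod:
  fixes f :: "complex \<Rightarrow> real" and a b :: complex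
  assumes "continuous_on (cbox a b) f"
  shows "integral (cbox (vector [Re a, Im a]) (vector [Re b, Im b])) (\<lambda>v :: real^2. f (Complex (v$1) (v$2)))
     = integral {Re a..Re b} (\<lambda>x. integral {Im a..Im b} (\<lambda>y. f (Complex x y)))" (is "integral ?B ?g = _")
proof -
  \<comment> \<open>\<open>P\<close> and \<open>V\<close> are mutually inverse coordinate maps. They
    send boxes to boxes of equal content, which carries the integral from \<open>real^2\<close>,
    where the area formula is applied, to pairs, where Fubini's theorem is.\<close>
  define P :: "real^2 \<Rightarrow> real \<times> real" where "P = (\<lambda>v. (v$1, v$2))"
  define V :: "real \<times> real \<Rightarrow> real^2" where "V = (\<lambda>p. vector [fst p, snd p])"
  let ?h = "\<lambda>p. f (Complex (fst p) (snd p))"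
  have PV: "P (V x) = x" "V (P v) = v" for x v
    by (auto simp: P_def V_def vec_eq_iff forall_2)
  have P_cbox: "P ` cbox u v = cbox (P u) (P v)" for u v
  proof -
    have "P x \<in> cbox (P u) (P v) \<longleftrightarrow> x \<in> cbox u v" for x
      by (auto simp: P_def mem_box_cart forall_2 cbox_Pair_eq)
    then show ?thesis using PV by (metis (mono_tags, opaque_lifting) image_iff subsetI subset_antisym)
  qed
  have V_cbox: "V ` cbox u v = cbox (V u) (V v)" for u v
    using P_cbox[of "V u" "V v"] PV by (metis (no_types, lifting) image_image image_cong image_ident)
  have cont: "continuous_on (cbox (Re a, Im a) (Re b, Im b)) ?h"
    by (rule continuous_on_compose2[OF assms])
       (auto intro!: continuous_intros simp: in_cbox_complex_iff cbox_Pair_eq Complex_eq)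
  have contentV: "measure lborel (V ` cbox u v) = 1 * measure lborel (cbox u v)" for u v
  proof -
    have ex2: "(\<exists>i::2. Q i) \<longleftrightarrow> Q 1 \<or> Q 2" for Q
      by (metis exhaust_2)
    obtain u1 u2 v1 v2 where uv: "u = (u1,u2)" "v = (v1,v2)" by (cases u, cases v)
    have "measure lborel (cbox (V u) (V v)) = measure lborel (cbox u v)"
      unfolding content_cbox_if_cart unfolding uv V_def content_Pair
      by (auto simp: prod_2 UNIV_2 interval_eq_empty_cart ex2 not_less measure_lborel_cbox_eq)
    then show ?thesis using V_cbox by simp
  qed
  have "((\<lambda>x. ?h (P x)) has_integral (1/1) *\<^sub>R integral (cbox (Re a, Im a) (Re b, Im b)) ?h) (V ` cbox (Re a, Im a) (Re b, Im b))"
  proof (rule has_integral_twiddle)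
    show "continuous (at x) P" for x unfolding P_def by (intro continuous_intros)
    show "\<exists>w z. P ` cbox u v = cbox w z" for u v using P_cbox by blast
    show "\<exists>w z. V ` cbox u v = cbox w z" for u v using V_cbox by blast
    show "measure lborel (P ` cbox u v) = 1 * measure lborel (cbox u v)" for u v
      using contentV[of "P u" "P v"] V_cbox P_cbox PV by simp
    show "(?h has_integral integral (cbox (Re a, Im a) (Re b, Im b)) ?h) (cbox (Re a, Im a) (Re b, Im b))"
      using integrable_continuous[OF cont] by blast
  qed (auto simp: PV)
  moreover have "V ` cbox (Re a, Im a) (Re b, Im b) = ?B"
    by (simp add: V_cbox) (simp add: V_def)
  ultimately have "integral ?B ?g = integral (cbox (Re a, Im a) (Re b, Im b)) ?h"
    by (simp add: integral_unique P_def)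
  then show ?thesis
    using integral_prod_continuous[OF cont] by simp
qed

text \<open>\<open>p\<close> and \<open>q\<close> are the Wirtinger derivatives of \<open>F\<close>,
  so the Jacobian is |p|^2 - |q|^2 >= 0, and by injectivity its integral is the area of the image.
  Injectivity is asked on the open box because \<open>F\<close> will contain \<open>exp\<close>,
  which identifies opposite edges of a box of height 2 pi.\<close>

lemma jacobian_integral_le_disc_area:
  fixes F p q :: "complex \<Rightarrow> complex"
  assumes der: "\<And>z. z \<in> cbox a b \<Longrightarrow> (F has_derivative (\<lambda>h. p z * h + q z * cnj h)) (at z)"
    and cont: "continuous_on (cbox a b) p" "continuous_on (cbox a b) q"
    and le: "\<And>z. z \<in> cbox a b \<Longrightarrow> norm (q z) \<le> norm (p z)"
    and inj: "inj_on F (box a b)"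
    and img: "F ` box a b \<subseteq> cball c R"
    and R: "0 \<le> R"
  shows "integral {Re a..Re b} (\<lambda>x. integral {Im a..Im b}
           (\<lambda>y. (norm (p (Complex x y)))\<^sup>2 - (norm (q (Complex x y)))\<^sup>2)) \<le> pi * R\<^sup>2"
proof -
  define C :: "real^2 \<Rightarrow> complex" where "C = (\<lambda>v. Complex (v$1) (v$2))"
  define V :: "complex \<Rightarrow> real^2" where "V = (\<lambda>z. vector [Re z, Im z])"
  define J where "J = (\<lambda>z. (norm (p z))\<^sup>2 - (norm (q z))\<^sup>2)"
  let ?S = "box (V a) (V b)"
  define f where "f = (\<lambda>v. V (F (C v)))"
  define f' where "f' = (\<lambda>v h. V (p (C v) * C h + q (C v) * cnj (C h)))"
  have CV: "C (V z) = z" "V (C v) = v" for z v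
    by (auto simp: C_def V_def vec_eq_iff forall_2)
  have blC: "bounded_linear C"
    by (rule linear_conv_bounded_linear[THEN iffD1], rule linearI) (auto simp: C_def complex_eq_iff)
  have blV: "bounded_linear V"
    by (rule linear_conv_bounded_linear[THEN iffD1], rule linearI) (auto simp: V_def vec_eq_iff forall_2)
  have C_box: "C v \<in> box a b \<longleftrightarrow> v \<in> ?S" "C v \<in> cbox a b \<longleftrightarrow> v \<in> cbox (V a) (V b)" for v
    by (auto simp: C_def V_def mem_box_cart forall_2 in_box_complex_iff in_cbox_complex_iff)
  have der_f: "(f has_derivative f' v) (at v within ?S)" if "v \<in> ?S" for v
  proof -
    have "(F has_derivative (\<lambda>h. p (C v) * h + q (C v) * cnj h)) (at (C v))"
      using that C_box box_subset_cbox by (intro der) blast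
    from bounded_linear.has_derivative[OF blV
        has_derivative_compose[OF bounded_linear_imp_has_derivative[OF blC] this]]
    have "((\<lambda>v. V (F (C v))) has_derivative (\<lambda>h. V (p (C v) * C h + q (C v) * cnj (C h)))) (at v)" .
    then show ?thesis unfolding f_def f'_def by (rule has_derivative_at_withinI)
  qed
  have inj_f: "inj_on f ?S"
  proof (rule inj_onI)
    fix u v assume "u \<in> ?S" "v \<in> ?S" "f u = f v"
    then have "F (C u) = F (C v)" unfolding f_def by (metis CV(1))
    then show "u = v" using inj C_box \<open>u \<in> ?S\<close> \<open>v \<in> ?S\<close> by (metis CV(2) inj_onD)
  qed
  have det: "\<bar>det (matrix (f' v))\<bar> = J (C v)" if "v \<in> cbox (V a) (V b)" for v
  proof -
    have "det (matrix (f' v)) = J (C v)"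
      unfolding J_def cmod_power2
      by (simp add: det_2 matrix_def f'_def V_def C_def axis_def power2_eq_square algebra_simps)
    moreover have "0 \<le> J (C v)"
      using le[of "C v"] that C_box unfolding J_def by (simp add: power_mono)
    ultimately show ?thesis by simp
  qed
  have contJ: "continuous_on (cbox a b) J"
    unfolding J_def by (intro continuous_intros cont)
  have cJC: "continuous_on (cbox (V a) (V b)) (\<lambda>v. J (C v))"
    by (rule continuous_on_compose2[OF contJ]) (use C_box in \<open>auto intro!: linear_continuous_on blC\<close>)
  have detS: "\<bar>det (matrix (f' v))\<bar> = J (C v)" if "v \<in> ?S" for v
    using det that box_subset_cbox by blast
  have int: "(\<lambda>v. \<bar>det (matrix (f' v))\<bar>) integrable_on ?S"
    using integrable_continuous[OF cJC] detS
    by (metis (no_types, lifting) integrable_on_open_interval integrable_eq)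
  have m: "f ` ?S \<in> lmeasurable" "measure lebesgue (f ` ?S) = integral ?S (\<lambda>v. \<bar>det (matrix (f' v))\<bar>)"
    using measure_differentiable_image_eq[OF _ der_f inj_f int] measurable_differentiable_image_eq[OF _ der_f inj_f] int
    by auto
  have dV: "dist (V w) (V z) = dist w z" for w z
    by (simp add: dist_norm V_def norm_eq_sqrt_inner inner_vec_def sum_2 inner_complex_def norm_eq_sqrt_inner)
  have "f ` ?S \<subseteq> cball (V c) R"
  proof
    fix w assume "w \<in> f ` ?S"
    then obtain v where "v \<in> ?S" "w = V (F (C v))" unfolding f_def by blast
    then have "F (C v) \<in> cball c R" using img C_box by blast
    then show "w \<in> cball (V c) R" by (simp add: dV \<open>w = _\<close>)
  qed
  then have "measure lebesgue (f ` ?S) \<le> measure lebesgue (cball (V c) R)"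
    using m(1) by (intro measure_mono_fmeasurable) (auto simp: fmeasurableD)
  also have "\<dots> = pi * R\<^sup>2"
    using R by (simp add: content_cball unit_ball_vol_2)
  finally have "integral ?S (\<lambda>v. \<bar>det (matrix (f' v))\<bar>) \<le> pi * R\<^sup>2" using m by simp
  moreover have "integral ?S (\<lambda>v. \<bar>det (matrix (f' v))\<bar>) = integral (cbox (V a) (V b)) (\<lambda>v. J (C v))"
    unfolding integral_open_interval by (rule integral_cong) (use det in auto)
  ultimately show ?thesis
    using integral_real2_eq_prod[OF contJ] unfolding V_def C_def J_def by simp
qed

subsection \<open>The area theorem\<close>

text \<open>On the circle, z f(z) dy = -\<i> f(z) dz, so this is the real part of Cauchy's theorem.
  It disposes of oscillating terms in mean squares.\<close>

lemma integral_circle_Re_eq_0: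
  assumes "f holomorphic_on ball 0 1" "0 < t" "t < 1"
  shows "((\<lambda>y. Re (of_real t * cis y * f (of_real t * cis y))) has_integral 0) {0..2*pi}"
proof -
  have "(f has_contour_integral 0) (circlepath 0 t)"
    using assms by (intro Cauchy_theorem_convex_simple[of f "ball 0 1"]) (auto simp: path_image_circlepath)
  then have "((\<lambda>y. f (of_real t * cis y) * of_real t * \<i> * cis y) has_integral 0) {0..2*pi}"
    unfolding circlepath_def by (subst (asm) has_contour_integral_part_circlepath_iff) auto
  from has_integral_linear[OF has_integral_mult_right[OF this, of "-\<i>"] bounded_linear_Re]
  show ?thesis by (simp add: o_def mult_ac)
qed

text \<open>A truncated Parseval identity that keeps only the coefficients of 1/z and z. With Q =
  -1/z + \<beta> z and X = z^2 m(z), dropping |X|^2 from |Q + X|^2 leaves a constant plus the real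
  part of z times a holomorphic function. In the application \<open>P\<close> is z times the
  derivative of 1/z + b(z), hence has no constant term.\<close>

lemma integral_circle_norm_square_ge:
  fixes \<beta> :: complex
  assumes m: "m holomorphic_on ball 0 1" and t: "0 < t" "t < 1"
  defines "P \<equiv> \<lambda>z. - 1 / z + \<beta> * z + z\<^sup>2 * m z"
  shows "2 * pi * (1 / t\<^sup>2 + (norm \<beta>)\<^sup>2 * t\<^sup>2) \<le> integral {0..2*pi} (\<lambda>y. (norm (P (of_real t * cis y)))\<^sup>2)"
proof -
  \<comment> \<open>Collects, divided by z, the oscillating part of |Q|^2 and the cross term
    \<open>cnj Q * (z\<^sup>2 * m z)\<close>. It is made holomorphic by substituting t^2 / z for
    \<open>cnj z\<close>, which is valid on |z| = t.\<close>
  define W where "W = (\<lambda>z. - \<beta> * z / t\<^sup>2 - z\<^sup>2 * m z / t\<^sup>2 + cnj \<beta> * t\<^sup>2 * m z)"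
  have holW: "W holomorphic_on ball 0 1"
    unfolding W_def using t by (intro holomorphic_intros m) auto
  have bound: "(1 / t\<^sup>2 + (norm \<beta>)\<^sup>2 * t\<^sup>2) + 2 * Re (z * W z) \<le> (norm (P z))\<^sup>2" if z: "norm z = t" for z
  proof -
    define Q where "Q = - 1 / z + \<beta> * z"
    have z0: "z \<noteq> 0" using z t by auto
    have zz: "cnj z = t\<^sup>2 / z"
      using complex_norm_square[of z] z z0 by (simp add: field_simps)
    have "of_real ((norm Q)\<^sup>2) = Q * cnj Q" by (rule complex_norm_square)
    also have "\<dots> = 1 / t\<^sup>2 + (norm \<beta>)\<^sup>2 * t\<^sup>2 - (\<beta> * z\<^sup>2 / t\<^sup>2 + cnj (\<beta> * z\<^sup>2 / t\<^sup>2))"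
      using z0 t complex_norm_square[of \<beta>] unfolding Q_def
      by (simp add: zz field_simps power2_eq_square)
    finally have "complex_of_real ((norm Q)\<^sup>2) =
        of_real (1 / t\<^sup>2 + (norm \<beta>)\<^sup>2 * t\<^sup>2) - (\<beta> * z\<^sup>2 / t\<^sup>2 + cnj (\<beta> * z\<^sup>2 / t\<^sup>2))"
      by simp
    then have Q: "(norm Q)\<^sup>2 = 1 / t\<^sup>2 + (norm \<beta>)\<^sup>2 * t\<^sup>2 - 2 * Re (\<beta> * z\<^sup>2 / t\<^sup>2)"
      unfolding complex_add_cnj of_real_diff[symmetric] of_real_eq_iff .
    have c: "cnj Q * (z\<^sup>2 * m z) = z * (- z\<^sup>2 * m z / t\<^sup>2 + cnj \<beta> * t\<^sup>2 * m z)"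
      using z0 t unfolding Q_def by (simp add: zz field_simps power2_eq_square)
    have "z * W z = cnj Q * (z\<^sup>2 * m z) - \<beta> * z\<^sup>2 / t\<^sup>2"
      unfolding W_def c by (simp add: algebra_simps power2_eq_square)
    then have "(1 / t\<^sup>2 + (norm \<beta>)\<^sup>2 * t\<^sup>2) + 2 * Re (z * W z) = (norm Q)\<^sup>2 + 2 * Re (cnj Q * (z\<^sup>2 * m z))"
      using Q by simp
    also have "\<dots> \<le> (norm (Q + z\<^sup>2 * m z))\<^sup>2"
    proof -
      have "(norm Q)\<^sup>2 + 2 * Re (cnj Q * X) + (norm X)\<^sup>2 = (norm (Q + X))\<^sup>2" for X
        unfolding cmod_power2 by (simp add: power2_eq_square algebra_simps)
      from this[of "z\<^sup>2 * m z"] show ?thesis using zero_le_power2[of "norm (z\<^sup>2 * m z)"] by linarith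
    qed
    finally show ?thesis unfolding P_def Q_def by simp
  qed
  have "((\<lambda>y. (1 / t\<^sup>2 + (norm \<beta>)\<^sup>2 * t\<^sup>2) + 2 * Re (of_real t * cis y * W (of_real t * cis y))) has_integral
      (2 * pi * (1 / t\<^sup>2 + (norm \<beta>)\<^sup>2 * t\<^sup>2) + 2 * 0)) {0..2*pi}"
    by (intro has_integral_add has_integral_mult_right integral_circle_Re_eq_0 holW t)
       (use has_integral_const_real[of "1 / t\<^sup>2 + (norm \<beta>)\<^sup>2 * t\<^sup>2" 0 "2*pi"] in simp)
  moreover have "continuous_on {0..2*pi} (\<lambda>y. (norm (P (of_real t * cis y)))\<^sup>2)"
    unfolding P_def using t
    by (intro continuous_intros continuous_on_compose2[OF holomorphic_on_imp_continuous_on[OF m]])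
       (auto simp: norm_mult)
  moreover have "(1 / t\<^sup>2 + (norm \<beta>)\<^sup>2 * t\<^sup>2) + 2 * Re (of_real t * cis y * W (of_real t * cis y))
      \<le> (norm (P (of_real t * cis y)))\<^sup>2" for y
    using t by (intro bound) (simp add: norm_mult)
  ultimately show ?thesis
    using has_integral_le[OF _ integrable_integral[OF integrable_continuous_real]] by force
qed

text \<open>The exterior region \<open>E\<close> is connected. The image of the punctured disk |z| <
  s meets \<open>E\<close> in a set that is open, closed in \<open>E\<close> because the circle |z|
  = s is not mapped into \<open>E\<close>, and nonempty because of the pole at 0. So this image
  covers \<open>E\<close>, and injectivity keeps all other points out of it.\<close>

lemma image_outside_disc:
  fixes b L :: "complex \<Rightarrow> complex"
  defines "G \<equiv> \<lambda>z. 1 / z + b z"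
  assumes b: "b holomorphic_on ball 0 1" and inj: "inj_on G (ball 0 1 - {0})"
    and s: "0 < s" "s < 1"
    and L: "bounded_linear L" "bij L" "\<And>w. norm w \<le> N * norm (L w)"
    and circ: "\<And>z. norm z = s \<Longrightarrow> norm (L (G z - c)) \<le> \<rho>"
    and z: "s \<le> norm z" "norm z < 1"
  shows "norm (L (G z - c)) \<le> \<rho>"
proof (rule ccontr)
  assume neg: "\<not> ?thesis"
  interpret L: bounded_linear L by fact
  define E where "E = {w. norm (L (w - c)) > \<rho>}"
  define A where "A = G ` (ball 0 s - {0})"
  define A' where "A' = G ` (cball 0 s - {0})"
  have rho: "0 \<le> \<rho>" using circ[of "of_real s"] s by (simp add: order.trans[OF norm_ge_zero])
  have "connected E"
  proof -
    have "bounded_linear (inv L)"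
      by (rule inj_linear_imp_inv_bounded_linear[OF L(1) bij_is_inj[OF L(2)]])
    then have cont: "continuous_on (- cball 0 \<rho>) (\<lambda>u. inv L u + c)"
      by (intro continuous_intros linear_continuous_on)
    have "E = (\<lambda>u. inv L u + c) ` (- cball 0 \<rho>)"
    proof -
      have "w \<in> (\<lambda>u. inv L u + c) ` (- cball 0 \<rho>)" if "w \<in> E" for w
        using that L(2) by (intro image_eqI[of _ _ "L (w - c)"]) (auto simp: E_def bij_is_inj)
      moreover have "inv L u + c \<in> E" if "u \<in> - cball 0 \<rho>" for u
        using that L(2) by (simp add: E_def bij_is_surj surj_f_inv_f)
      ultimately show ?thesis by blast
    qed
    then show ?thesis
      using cont connected_continuous_image[of "- cball (0::complex) \<rho>"]
        connected_complement_bounded_convex[of "cball (0::complex) \<rho>"] by simp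
  qed
  have holG: "G holomorphic_on ball 0 1 - {0}"
    unfolding G_def by (intro holomorphic_intros holomorphic_on_subset[OF b]) auto
  have "open A" unfolding A_def
  proof (rule invariance_of_domain)
    show "continuous_on (ball 0 s - {0}) G"
      using s by (intro continuous_on_subset[OF holomorphic_on_imp_continuous_on[OF holG]]) auto
    show "inj_on G (ball 0 s - {0})"
      by (rule inj_on_subset[OF inj]) (use s in auto)
  qed (auto simp: open_delete)
  moreover have "closed A'"
  proof -
    \<comment> \<open>\<open>A'\<close> is closed in spite of the pole: clearing the denominator in
      w = G z gives a closed condition that has no solution with z = 0, and projecting along the
      compact \<open>cball 0 s\<close> preserves closedness.\<close>
    define T where "T = {(z, w). z \<in> cball 0 s \<and> z * w = 1 + z * b z}"
    have T: "T = {p \<in> cball 0 s \<times> UNIV. fst p * snd p - (1 + fst p * b (fst p)) = 0}"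
      by (auto simp: T_def)
    have "continuous_on (cball 0 s \<times> UNIV) (\<lambda>p :: complex \<times> complex. fst p * snd p - (1 + fst p * b (fst p)))"
      by (intro continuous_intros continuous_on_compose2[OF holomorphic_on_imp_continuous_on[OF b]])
         (use s in auto)
    then have "closed T"
      unfolding T by (intro continuous_closed_preimage_constant closed_Times) auto
    then have "closed {w. \<exists>z. z \<in> cball 0 s \<and> (z, w) \<in> T}"
      by (intro closed_compact_projection) auto
    moreover have "{w. \<exists>z. z \<in> cball 0 s \<and> (z, w) \<in> T} = A'"
    proof (intro set_eqI iffI)
      fix w assume "w \<in> {w. \<exists>z. z \<in> cball 0 s \<and> (z, w) \<in> T}"
      then obtain z where z: "z \<in> cball 0 s" "z * w = 1 + z * b z" unfolding T_def by blast
      then have "z \<noteq> 0" by auto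
      then have "w = G z" using z unfolding G_def by (simp add: field_simps)
      then show "w \<in> A'" unfolding A'_def using z \<open>z \<noteq> 0\<close> by blast
    next
      fix w assume "w \<in> A'"
      then obtain z where z: "z \<in> cball 0 s" "z \<noteq> 0" "w = G z" unfolding A'_def by blast
      then have "z * w = 1 + z * b z" unfolding G_def by (simp add: field_simps)
      then show "w \<in> {w. \<exists>z. z \<in> cball 0 s \<and> (z, w) \<in> T}" using z unfolding T_def by blast
    qed
    ultimately show ?thesis by simp
  qed
  moreover have "E \<inter> A' \<subseteq> A"
  proof
    fix w assume w: "w \<in> E \<inter> A'"
    then obtain z where "w = G z" "z \<in> cball 0 s - {0}" unfolding A'_def by blast
    moreover have "norm z \<noteq> s" using circ[of z] w calculation unfolding E_def by auto
    ultimately show "w \<in> A" unfolding A_def by auto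
  qed
  moreover have "A \<subseteq> A'" unfolding A_def A'_def by (intro image_mono) auto
  moreover have "E \<inter> A \<noteq> {}"
  proof -
    have "bounded (b ` cball 0 s)"
      using s by (intro compact_imp_bounded compact_continuous_image
          continuous_on_subset[OF holomorphic_on_imp_continuous_on[OF b]]) auto
    then obtain M where M: "\<And>z. norm z \<le> s \<Longrightarrow> norm (b z) \<le> M"
      unfolding bounded_iff by (metis image_eqI mem_cball_0)
    \<comment> \<open>At y = 1/K the polar term has modulus K. The summand 1/s places y in the disk
      |y| < s, and the others absorb \<open>b y\<close>, \<open>c\<close> and the constant of
      \<open>L\<close>.\<close>
    define K where "K = 1 / s + \<bar>M\<bar> + norm c + \<bar>N\<bar> * \<rho> + 1"
    have K: "K > 1 / s" unfolding K_def using rho by (simp add: add_pos_nonneg add_nonneg_pos)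
    have s': "1 / s > 0" using s by simp
    then have K0: "K > 0" using K by linarith
    define y where "y = complex_of_real (1 / K)"
    have y: "y \<noteq> 0" "norm y < s" "norm (1 / y) = K"
      using K K0 s by (auto simp: y_def norm_divide field_simps)
    have "K \<le> norm (G y - c) + norm (b y) + norm c"
      using norm_triangle_ineq4[of "G y - c" "b y - c"] norm_triangle_ineq4[of "b y" c] y
      by (simp add: G_def)
    also have "norm (b y) \<le> \<bar>M\<bar>" using M[of y] y by simp
    finally have "\<bar>N\<bar> * \<rho> < norm (G y - c)" unfolding K_def using s' by linarith
    also have "norm (G y - c) \<le> \<bar>N\<bar> * norm (L (G y - c))"
      by (rule order.trans[OF L(3) mult_right_mono]) auto
    finally have "\<rho> < norm (L (G y - c))"
      by (rule mult_left_less_imp_less) simp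
    then show ?thesis unfolding E_def A_def using y by auto
  qed
  ultimately have "E \<subseteq> A"
    using \<open>connected E\<close> connectedD[of E A "- A'"] by blast
  moreover have "G z \<in> E" using neg by (simp add: E_def)
  ultimately obtain z' where "z' \<in> ball 0 s - {0}" "G z = G z'" unfolding A_def by blast
  moreover have "z \<in> ball 0 1 - {0}" "z' \<in> ball 0 1 - {0}" using z s calculation by auto
  ultimately show False using inj_onD[OF inj, of z z'] z by auto
qed

text \<open>In the coordinate x = ln |z| the circle bounds for t = exp x are integrated;
  \<open>\<Phi>\<close> is an antiderivative of 2 pi (exp (-2x) + |\<beta>|^2 exp (2x)).\<close>

lemma integral_annulus_norm_square_ge:
  fixes \<beta> :: complex
  assumes m: "m holomorphic_on ball 0 1" and t: "0 < s" "s < r" "r < 1"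
  defines "P \<equiv> \<lambda>z. - 1 / z + \<beta> * z + z\<^sup>2 * m z"
  shows "pi * (1 / s\<^sup>2 - 1 / r\<^sup>2 + (norm \<beta>)\<^sup>2 * (r\<^sup>2 - s\<^sup>2)) \<le>
    integral {ln s..ln r} (\<lambda>x. integral {0..2*pi} (\<lambda>y. (norm (P (exp (Complex x y))))\<^sup>2))"
proof -
  define \<Phi> where "\<Phi> = (\<lambda>x. pi * (- exp (- 2 * x) + (norm \<beta>)\<^sup>2 * exp (2 * x)))"
  let ?I = "\<lambda>x. integral {0..2*pi} (\<lambda>y. (norm (P (exp (Complex x y))))\<^sup>2)"
  have ln_le: "ln s \<le> ln r" using t by simp
  have exp2: "exp (2 * ln u) = u\<^sup>2" "exp (- (2 * ln u)) = 1 / u\<^sup>2" if "u > 0" for u :: real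
    using that by (simp_all add: exp_minus exp_double exp_ln divide_simps flip: exp_of_nat_mult)
  have cont: "continuous_on (cbox (ln s, 0) (ln r, 2*pi)) (\<lambda>(x,y). (norm (P (exp (Complex x y))))\<^sup>2)"
  proof -
    have "norm (exp (complex_of_real (fst p) + \<i> * complex_of_real (snd p))) < 1"
      if "p \<in> cbox (ln s, 0) (ln r, 2*pi)" for p
    proof -
      have "fst p \<le> ln r" using that by (cases p) (simp add: cbox_Pair_eq)
      also have "\<dots> < 0" using t by simp
      finally show ?thesis by (simp add: norm_exp_eq_Re)
    qed
    then show ?thesis
      unfolding P_def Complex_eq case_prod_unfold
      by (intro continuous_intros continuous_on_compose2[OF holomorphic_on_imp_continuous_on[OF m]]) auto
  qed
  have "(\<lambda>x. integral (cbox 0 (2*pi)) (\<lambda>y. (\<lambda>(x,y). (norm (P (exp (Complex x y))))\<^sup>2) (x, y))) integrable_on cbox (ln s) (ln r)"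
    by (rule integral_integrable_2dim[OF cont])
  then have int: "?I integrable_on {ln s..ln r}" by simp
  have "((\<lambda>x. 2 * pi * (exp (- 2 * x) + (norm \<beta>)\<^sup>2 * exp (2 * x))) has_integral \<Phi> (ln r) - \<Phi> (ln s)) {ln s..ln r}"
    unfolding \<Phi>_def
    by (rule fundamental_theorem_of_calculus[OF ln_le])
       (auto intro!: derivative_eq_intros simp: algebra_simps simp flip: has_real_derivative_iff_has_vector_derivative)
  moreover have "2 * pi * (exp (- 2 * x) + (norm \<beta>)\<^sup>2 * exp (2 * x)) \<le> ?I x" if x: "x \<in> {ln s..ln r}" for x
  proof -
    have "exp x \<le> r" using x t by (metis atLeastAtMost_iff exp_le_cancel_iff exp_ln order.strict_trans)
    then have "2 * pi * (1 / (exp x)\<^sup>2 + (norm \<beta>)\<^sup>2 * (exp x)\<^sup>2) \<le> integral {0..2*pi} (\<lambda>y. (norm (P (of_real (exp x) * cis y)))\<^sup>2)"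
      unfolding P_def using t by (intro integral_circle_norm_square_ge m) (auto simp del: exp_less_one_iff)
    moreover have "1 / (exp x)\<^sup>2 = exp (- 2 * x)" "(exp x)\<^sup>2 = exp (2 * x)"
      by (simp_all add: exp_double exp_minus divide_simps)
    moreover have "exp (Complex x y) = of_real (exp x) * cis y" for y
      by (simp add: exp_eq_polar)
    ultimately show ?thesis by simp
  qed
  ultimately have "\<Phi> (ln r) - \<Phi> (ln s) \<le> integral {ln s..ln r} ?I"
    using int by (intro has_integral_le[OF _ integrable_integral[OF int]]) auto
  moreover have "\<Phi> (ln r) - \<Phi> (ln s) = pi * (1 / s\<^sup>2 - 1 / r\<^sup>2 + (norm \<beta>)\<^sup>2 * (r\<^sup>2 - s\<^sup>2))"
    using t by (simp add: \<Phi>_def exp2) (simp add: algebra_simps)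
  ultimately show ?thesis by simp
qed

text \<open>
  \<open>z \<mapsto> 1/z + \<beta> z\<close> sends the circle of radius \<open>s\<close> to an ellipse, which the real-linear map
  \<open>L w = w - s\<^sup>2 \<beta> cnj w\<close> turns into a circle. Hence the area of the image of an
  annulus under \<open>L \<circ> G\<close> is at most that of a disk, up to an error vanishing with \<open>s\<close>.
\<close>

lemma area_estimate:
  fixes b :: "complex \<Rightarrow> complex"
  defines "G \<equiv> \<lambda>z. 1 / z + b z" and "\<beta> \<equiv> deriv b 0"
  assumes b: "b holomorphic_on ball 0 1" and inj: "inj_on G (ball 0 1 - {0})"
    and l: "\<And>z. norm z < 1 \<Longrightarrow> b z = b 0 + \<beta> * z + z\<^sup>2 * l z"
    and s: "0 < s" "s < r" "r < 1" "s\<^sup>2 * norm \<beta> < 1"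
    and M: "\<And>z. norm z = s \<Longrightarrow> norm (l z) \<le> M"
  shows "(1 - s^4 * (norm \<beta>)\<^sup>2) * (1 / s\<^sup>2 - 1 / r\<^sup>2 + (norm \<beta>)\<^sup>2 * (r\<^sup>2 - s\<^sup>2))
    \<le> (1 / s - s^3 * (norm \<beta>)\<^sup>2 + 2 * M * s\<^sup>2)\<^sup>2"
proof -
  define \<kappa> where "\<kappa> = s\<^sup>2 * \<beta>"
  define L where "L = (\<lambda>w. w - \<kappa> * cnj w)"
  define \<rho> where "\<rho> = 1 / s - s^3 * (norm \<beta>)\<^sup>2 + 2 * M * s\<^sup>2"
  have nk: "norm \<kappa> = s\<^sup>2 * norm \<beta>" by (simp add: \<kappa>_def norm_mult norm_power)
  have k1: "norm \<kappa> < 1" using s nk by simp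
  have k2: "(norm \<kappa>)\<^sup>2 = s^4 * (norm \<beta>)\<^sup>2" unfolding nk by (simp add: power_mult_distrib)
  have blL: "bounded_linear L"
    unfolding L_def by (intro bounded_linear_intros bounded_linear_cnj bounded_linear_const_mult)
  have L_ge: "norm w \<le> 1 / (1 - norm \<kappa>) * norm (L w)" for w
  proof -
    have "norm w - norm \<kappa> * norm w \<le> norm (L w)"
      using norm_triangle_ineq2[of w "\<kappa> * cnj w"] by (simp add: L_def norm_mult)
    then show ?thesis using k1 by (simp add: field_simps)
  qed
  have L_le: "norm (L w) \<le> 2 * norm w" for w
  proof -
    have "norm (L w) \<le> norm w + norm \<kappa> * norm w"
      using norm_triangle_ineq4[of w "\<kappa> * cnj w"] by (simp add: L_def norm_mult)
    also have "norm \<kappa> * norm w \<le> 1 * norm w" using k1 by (intro mult_right_mono) auto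
    finally show ?thesis by simp
  qed
  have injL: "inj L"
  proof (rule injI)
    fix u v assume "L u = L v"
    then have "L (u - v) = 0" using linear_diff[OF bounded_linear.linear[OF blL]] by simp
    then show "u = v" using L_ge[of "u - v"] by simp
  qed
  have bijL: "bij L"
    using injL linear_injective_imp_surjective[OF bounded_linear.linear[OF blL]] by (simp add: bij_def)
  have circ: "norm (L (G z - b 0)) \<le> \<rho>" if z: "norm z = s" for z
  proof -
    have z0: "z \<noteq> 0" using z s by auto
    have zz: "cnj z = s\<^sup>2 / z"
      using complex_norm_square[of z] z z0 by (simp add: field_simps)
    \<comment> \<open>On |z| = s the conjugate of 1/z is z / s^2, so the subtracted term cancels
      \<beta> z and leaves a real multiple of 1/z.\<close>
    have "L (1 / z + \<beta> * z) = (1 / s\<^sup>2 - s\<^sup>2 * (norm \<beta>)\<^sup>2) * cnj z"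
      using z0 s complex_norm_square[of \<beta>] unfolding L_def \<kappa>_def
      by (simp add: zz field_simps power2_eq_square)
    then have eq: "norm (L (1 / z + \<beta> * z)) = \<bar>1 / s\<^sup>2 - s\<^sup>2 * (norm \<beta>)\<^sup>2\<bar> * s"
      using z by (simp only: norm_mult norm_of_real complex_mod_cnj abs_mult)
    have "s\<^sup>2 * (norm \<beta>)\<^sup>2 \<le> 1 / s\<^sup>2"
    proof -
      have "s\<^sup>2 * (norm \<beta>)\<^sup>2 * s\<^sup>2 = (s\<^sup>2 * norm \<beta>)\<^sup>2" by (simp add: power_mult_distrib power2_eq_square)
      also have "\<dots> \<le> 1" using s by (simp add: power_le_one)
      finally show ?thesis using s by (simp add: field_simps)
    qed
    then have "norm (L (1 / z + \<beta> * z)) = (1 / s\<^sup>2 - s\<^sup>2 * (norm \<beta>)\<^sup>2) * s" using eq by simp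
    also have "\<dots> = 1 / s - s^3 * (norm \<beta>)\<^sup>2"
      using s by (simp add: field_simps power2_eq_square power3_eq_cube)
    finally have 1: "norm (L (1 / z + \<beta> * z)) = 1 / s - s^3 * (norm \<beta>)\<^sup>2" .
    have "norm (L (z\<^sup>2 * l z)) \<le> 2 * (s\<^sup>2 * norm (l z))"
      using L_le[of "z\<^sup>2 * l z"] z by (simp add: norm_mult norm_power)
    also have "\<dots> \<le> 2 * (s\<^sup>2 * M)" using M[OF z] by (intro mult_left_mono) auto
    finally have 2: "norm (L (z\<^sup>2 * l z)) \<le> 2 * M * s\<^sup>2" by (simp add: mult_ac)
    have "G z - b 0 = (1 / z + \<beta> * z) + z\<^sup>2 * l z" using l[of z] z s by (simp add: G_def)
    then have "L (G z - b 0) = L (1 / z + \<beta> * z) + L (z\<^sup>2 * l z)"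
      using linear_add[OF bounded_linear.linear[OF blL]] by simp
    then show ?thesis using norm_triangle_ineq[of "L (1 / z + \<beta> * z)" "L (z\<^sup>2 * l z)"] 1 2 by (simp add: \<rho>_def)
  qed
  have rho0: "0 \<le> \<rho>" using circ[of "of_real s"] s by (simp add: order.trans[OF norm_ge_zero])
  \<comment> \<open>Composition with \<open>exp\<close> turns the annulus into a rectangle of height
    2 pi, and the derivative of \<open>G (exp \<zeta>)\<close> in \<zeta> is
    \<open>P (exp \<zeta>)\<close>.\<close>
  define F where "F = (\<lambda>\<zeta>. L (G (exp \<zeta>) - b 0))"
  define P where "P = (\<lambda>z. - 1 / z + z * deriv b z)"
  define a' b' where "a' = Complex (ln s) 0" and "b' = Complex (ln r) (2*pi)"
  have ann: "s \<le> norm (exp \<zeta>)" "norm (exp \<zeta>) < 1" if "\<zeta> \<in> cbox a' b'" for \<zeta>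
  proof -
    have "ln s \<le> Re \<zeta>" "Re \<zeta> \<le> ln r" using that by (auto simp: in_cbox_complex_iff a'_def b'_def)
    moreover have "r > 0" using s by simp
    ultimately have "s \<le> exp (Re \<zeta>)" "exp (Re \<zeta>) \<le> r" using s
      by (metis exp_le_cancel_iff exp_ln)+
    then show "s \<le> norm (exp \<zeta>)" "norm (exp \<zeta>) < 1" using s by (simp_all add: norm_exp_eq_Re del: exp_less_one_iff)
  qed
  have "integral {Re a'..Re b'} (\<lambda>x. integral {Im a'..Im b'}
      (\<lambda>y. (norm (P (exp (Complex x y))))\<^sup>2 - (norm (- \<kappa> * cnj (P (exp (Complex x y)))))\<^sup>2)) \<le> pi * \<rho>\<^sup>2"
  proof (rule jacobian_integral_le_disc_area)
    fix \<zeta> assume z: "\<zeta> \<in> cbox a' b'"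
    have "(b has_field_derivative deriv b (exp \<zeta>)) (at (exp \<zeta>))"
      using ann[OF z] by (intro holomorphic_derivI[OF b]) auto
    then have 1: "((\<lambda>\<zeta>. b (exp \<zeta>)) has_field_derivative deriv b (exp \<zeta>) * exp \<zeta>) (at \<zeta>)"
      by (rule DERIV_chain2) (rule DERIV_exp)
    have 2: "((\<lambda>\<zeta>. 1 / exp \<zeta>) has_field_derivative - 1 / exp \<zeta>) (at \<zeta>)"
      by (auto intro!: derivative_eq_intros)
    have "((\<lambda>\<zeta>. G (exp \<zeta>) - b 0) has_field_derivative - 1 / exp \<zeta> + deriv b (exp \<zeta>) * exp \<zeta> - 0) (at \<zeta>)"
      unfolding G_def by (intro DERIV_diff DERIV_add 1 2 DERIV_const)
    then have "((\<lambda>\<zeta>. G (exp \<zeta>) - b 0) has_field_derivative P (exp \<zeta>)) (at \<zeta>)"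
      by (simp add: P_def mult.commute)
    then have "((\<lambda>\<zeta>. G (exp \<zeta>) - b 0) has_derivative (\<lambda>h. P (exp \<zeta>) * h)) (at \<zeta>)"
      unfolding has_field_derivative_def .
    from bounded_linear.has_derivative[OF blL this]
    show "(F has_derivative (\<lambda>h. P (exp \<zeta>) * h + - \<kappa> * cnj (P (exp \<zeta>)) * cnj h)) (at \<zeta>)"
      unfolding F_def by (simp add: L_def algebra_simps)
  next
    show c: "continuous_on (cbox a' b') (\<lambda>\<zeta>. P (exp \<zeta>))"
      unfolding P_def
      by (intro continuous_intros
          continuous_on_compose2[OF holomorphic_on_imp_continuous_on[OF holomorphic_deriv[OF b]]])
         (use ann in auto)
    show "continuous_on (cbox a' b') (\<lambda>\<zeta>. - \<kappa> * cnj (P (exp \<zeta>)))"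
      by (intro continuous_intros c)
    show "norm (- \<kappa> * cnj (P (exp \<zeta>))) \<le> norm (P (exp \<zeta>))" for \<zeta>
      using k1 by (simp add: norm_mult mult_left_le_one_le)
  next
    show "inj_on F (box a' b')"
    proof (rule inj_onI)
      fix u v assume uv: "u \<in> box a' b'" "v \<in> box a' b'" "F u = F v"
      then have "u \<in> cbox a' b'" "v \<in> cbox a' b'" using box_subset_cbox by blast+
      then have "exp u \<in> ball 0 1 - {0}" "exp v \<in> ball 0 1 - {0}"
        using ann(2)[of u] ann(2)[of v] by (simp_all del: norm_exp_eq_Re)
      moreover have "G (exp u) = G (exp v)" using uv(3) injL unfolding F_def by (simp add: inj_eq)
      ultimately have "exp u = exp v" using inj by (meson inj_onD)
      moreover have "\<bar>Im u - Im v\<bar> < 2 * pi"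
        using uv(1,2) unfolding in_box_complex_iff a'_def b'_def complex.sel greaterThanLessThan_iff by linarith
      ultimately show "u = v" using exp_complex_eqI by blast
    qed
    show "F ` box a' b' \<subseteq> cball 0 \<rho>"
    proof clarify
      fix u assume "u \<in> box a' b'"
      then have "u \<in> cbox a' b'" using box_subset_cbox by blast
      then have u: "s \<le> norm (exp u)" "norm (exp u) < 1" using ann by blast+
      then have "norm (F u) \<le> \<rho>"
        using image_outside_disc[OF b inj[unfolded G_def] s(1) _ blL bijL L_ge circ[unfolded G_def] u] s
        by (simp add: F_def G_def)
      then show "F u \<in> cball 0 \<rho>" by simp
    qed
  qed (rule rho0)
  \<comment> \<open>\<open>L\<close> is real-linear with determinant 1 - |\<kappa>|^2, so it scales
    all areas by this constant.\<close>
  also have "(\<lambda>x y. (norm (P (exp (Complex x y))))\<^sup>2 - (norm (- \<kappa> * cnj (P (exp (Complex x y)))))\<^sup>2)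
      = (\<lambda>x y. (1 - (norm \<kappa>)\<^sup>2) * (norm (P (exp (Complex x y))))\<^sup>2)"
    by (simp add: norm_mult power_mult_distrib algebra_simps)
  finally have "(1 - (norm \<kappa>)\<^sup>2) * integral {ln s..ln r} (\<lambda>x. integral {0..2*pi}
      (\<lambda>y. (norm (P (exp (Complex x y))))\<^sup>2)) \<le> pi * \<rho>\<^sup>2"
    by (simp add: a'_def b'_def)
  moreover have "pi * (1 / s\<^sup>2 - 1 / r\<^sup>2 + (norm \<beta>)\<^sup>2 * (r\<^sup>2 - s\<^sup>2)) \<le> integral {ln s..ln r} (\<lambda>x. integral {0..2*pi}
      (\<lambda>y. (norm (P (exp (Complex x y))))\<^sup>2))"
  proof -
    have "(\<lambda>z. deriv b z - \<beta>) holomorphic_on ball 0 1"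
      by (intro holomorphic_intros b) auto
    then obtain m where m: "m holomorphic_on ball 0 1" "\<And>z. norm z < 1 \<Longrightarrow> deriv b z - \<beta> = z * m z"
      by (rule Schwarz3) (auto simp: \<beta>_def)
    have Peq: "P z = - 1 / z + \<beta> * z + z\<^sup>2 * m z" if "norm z < 1" for z
    proof -
      have "deriv b z = \<beta> + z * m z" using m(2)[OF that] by (simp add: algebra_simps)
      then show ?thesis by (simp add: P_def algebra_simps power2_eq_square)
    qed
    have eq: "integral {ln s..ln r} (\<lambda>x. integral {0..2*pi} (\<lambda>y. (norm (P (exp (Complex x y))))\<^sup>2)) =
      integral {ln s..ln r} (\<lambda>x. integral {0..2*pi} (\<lambda>y. (norm (- 1 / exp (Complex x y)
         + \<beta> * exp (Complex x y) + (exp (Complex x y))\<^sup>2 * m (exp (Complex x y))))\<^sup>2))"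
    proof (intro integral_cong)
      fix x y assume "x \<in> {ln s..ln r}" "y \<in> {0..2*pi}"
      then have "Complex x y \<in> cbox a' b'" by (simp add: in_cbox_complex_iff a'_def b'_def)
      from Peq[OF ann(2)[OF this]]
      show "(norm (P (exp (Complex x y))))\<^sup>2 = (norm (- 1 / exp (Complex x y)
         + \<beta> * exp (Complex x y) + (exp (Complex x y))\<^sup>2 * m (exp (Complex x y))))\<^sup>2" by (simp only:)
    qed
    show ?thesis
      unfolding eq by (rule integral_annulus_norm_square_ge[OF m(1) s(1-3)])
  qed
  moreover have "0 \<le> 1 - (norm \<kappa>)\<^sup>2" using k1 by (simp add: power_le_one)
  ultimately have "(1 - (norm \<kappa>)\<^sup>2) * (pi * (1 / s\<^sup>2 - 1 / r\<^sup>2 + (norm \<beta>)\<^sup>2 * (r\<^sup>2 - s\<^sup>2))) \<le> pi * \<rho>\<^sup>2"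
    by (meson mult_left_mono order.trans)
  then have "pi * ((1 - (norm \<kappa>)\<^sup>2) * (1 / s\<^sup>2 - 1 / r\<^sup>2 + (norm \<beta>)\<^sup>2 * (r\<^sup>2 - s\<^sup>2))) \<le> pi * \<rho>\<^sup>2"
    by (simp add: mult_ac)
  then show ?thesis unfolding k2 \<rho>_def by (simp only: mult_le_cancel_left_pos[OF pi_gt_zero])
qed

text \<open>Gronwall's area theorem for the first coefficient. In \<open>area_estimate\<close> the
  terms 1/s^2 cancel; letting s tend to 0 leaves |\<beta>|^2 r^2 <= 1/r^2, and then r tends to
  1.\<close>

theorem area_theorem:
  assumes b: "b holomorphic_on ball 0 1" and inj: "inj_on (\<lambda>z. 1 / z + b z) (ball 0 1 - {0})"
  shows "norm (deriv b 0) \<le> 1"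
proof -
  define \<beta> where "\<beta> = deriv b 0"
  have "(\<lambda>z. b z - b 0) holomorphic_on ball 0 1" by (intro holomorphic_intros b)
  then obtain k where k: "k holomorphic_on ball 0 1" "\<And>z. norm z < 1 \<Longrightarrow> b z - b 0 = z * k z"
      "deriv (\<lambda>z. b z - b 0) 0 = k 0"
    by (rule Schwarz3) auto
  have "b field_differentiable at 0"
    using b by (auto intro!: holomorphic_on_imp_differentiable_at[of b "ball 0 1"])
  then have k0: "k 0 = \<beta>" using k(3) by (simp add: \<beta>_def)
  have "(\<lambda>z. k z - \<beta>) holomorphic_on ball 0 1" by (intro holomorphic_intros k)
  then obtain l where l: "l holomorphic_on ball 0 1" "\<And>z. norm z < 1 \<Longrightarrow> k z - \<beta> = z * l z"
    by (rule Schwarz3) (auto simp: k0)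
  have bl: "b z = b 0 + \<beta> * z + z\<^sup>2 * l z" if "norm z < 1" for z
    using k(2)[OF that] l(2)[OF that] by (simp add: algebra_simps power2_eq_square)
  have "bounded (l ` cball 0 (1/2))"
    by (intro compact_imp_bounded compact_continuous_image
          continuous_on_subset[OF holomorphic_on_imp_continuous_on[OF l(1)]]) auto
  then obtain M where M: "\<And>z. norm z \<le> 1/2 \<Longrightarrow> norm (l z) \<le> M"
    unfolding bounded_iff by (metis image_eqI mem_cball_0)
  define B where "B = norm \<beta>"
  have main: "B\<^sup>2 * r\<^sup>2 \<le> 1 / r\<^sup>2" if r: "0 < r" "r < 1" for r
  proof -
    let ?f = "\<lambda>s. (1 / s - s^3 * B\<^sup>2 + 2 * M * s\<^sup>2)\<^sup>2 - (1 - s^4 * B\<^sup>2) * (1 / s\<^sup>2 - 1 / r\<^sup>2 + B\<^sup>2 * (r\<^sup>2 - s\<^sup>2))"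
    \<comment> \<open>\<open>?f\<close> is the difference of the two sides of
      \<open>area_estimate\<close>. In \<open>?p\<close> the poles in s have been cancelled, so its
      limit at 0 can be read off.\<close>
    let ?p = "\<lambda>s. s^6 * B^4 + 4 * M\<^sup>2 * s^4 - s\<^sup>2 * B\<^sup>2 + 4 * M * s - 4 * M * s^5 * B\<^sup>2
        - (1 - s^4 * B\<^sup>2) * (B\<^sup>2 * (r\<^sup>2 - s\<^sup>2) - 1 / r\<^sup>2)"
    have "?p s = ?f s" if "0 < s" for s
    proof -
      have "(1 / s - s^3 * B\<^sup>2 + 2 * M * s\<^sup>2)\<^sup>2 =
          1 / s\<^sup>2 + s^6 * B^4 + 4 * M\<^sup>2 * s^4 - 2 * s\<^sup>2 * B\<^sup>2 + 4 * M * s - 4 * M * s^5 * B\<^sup>2"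
        using that by (simp add: field_simps power2_eq_square power_numeral_reduce)
      moreover have "s^4 * B\<^sup>2 * (1 / s\<^sup>2) = s\<^sup>2 * B\<^sup>2"
        using that by (simp add: power2_eq_square power_numeral_reduce)
      ultimately show ?thesis by (simp add: algebra_simps)
    qed
    then have "\<forall>\<^sub>F s in at_right 0. ?p s = ?f s"
      by (auto simp: eventually_at_right_less eventually_at_filter)
    moreover have "(?p \<longlongrightarrow> 1 / r\<^sup>2 - B\<^sup>2 * r\<^sup>2) (at_right 0)"
      by (auto intro!: tendsto_eq_intros)
    ultimately have lim: "(?f \<longlongrightarrow> 1 / r\<^sup>2 - B\<^sup>2 * r\<^sup>2) (at_right 0)"
      using tendsto_cong by fast
    have "((\<lambda>s. s\<^sup>2 * B) \<longlongrightarrow> 0) (at_right 0)"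
      by (auto intro!: tendsto_eq_intros)
    then have "\<forall>\<^sub>F s in at_right 0. s\<^sup>2 * B < 1"
      by (rule order_tendstoD) simp
    moreover have "\<forall>\<^sub>F s in at_right 0. s \<in> {0<..<min r (1/2)}"
      using r by (intro eventually_at_right_real) auto
    ultimately have "\<forall>\<^sub>F s in at_right 0. 0 \<le> ?f s"
    proof eventually_elim
      case (elim s)
      then show ?case
        using area_estimate[OF b inj bl[unfolded \<beta>_def] , of s r M] M r
        by (simp add: B_def \<beta>_def)
    qed
    then have "0 \<le> 1 / r\<^sup>2 - B\<^sup>2 * r\<^sup>2"
      using lim by (intro tendsto_lowerbound[of ?f _ "at_right 0"]) auto
    then show ?thesis by simp
  qed
  have "((\<lambda>r. 1 / r\<^sup>2 - B\<^sup>2 * r\<^sup>2) \<longlongrightarrow> 1 - B\<^sup>2) (at_left 1)"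
    by (auto intro!: tendsto_eq_intros)
  moreover have "\<forall>\<^sub>F r in at_left 1. 0 \<le> 1 / r\<^sup>2 - B\<^sup>2 * r\<^sup>2"
    using eventually_at_left_real[OF zero_less_one] by eventually_elim (use main in auto)
  ultimately have "0 \<le> 1 - B\<^sup>2"
    by (intro tendsto_lowerbound[of _ _ "at_left 1"]) auto
  then show ?thesis unfolding B_def \<beta>_def by (simp add: power2_le_iff_abs_le abs_square_le_1)
qed

subsection \<open>The distortion theorem\<close>

text \<open>Bieberbach's bound |a_2| <= 2, since f''(0) = 2 a_2. With f = z P^2, the function z
  P(z^2) is an odd square root of f(z^2), and its reciprocal is 1/z + z k(z^2) with k(0) = -P'(0).
  On the other hand f''(0) = 4 P'(0).\<close>

lemma class_S_deriv2_le:
  assumes "f \<in> class_S"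
  shows "norm (deriv (deriv f) 0) \<le> 4"
proof -
  have f: "f holomorphic_on ball 0 1" "inj_on f (ball 0 1)" "f 0 = 0" "deriv f 0 = 1"
    using assms by (auto simp: class_S_def)
  obtain q where q: "q holomorphic_on ball 0 1" "\<And>z. norm z < 1 \<Longrightarrow> f z = z * q z" "q 0 = 1"
    using Schwarz3[OF f(1,3)] f(4) by metis
  have "q z \<noteq> 0" if "z \<in> ball 0 1" for z
  proof
    assume "q z = 0"
    then have "f z = f 0" using q(2)[of z] that f(3) by simp
    then have "z = 0" using inj_onD[OF f(2)] that by simp
    then show False using \<open>q z = 0\<close> q(3) by simp
  qed
  then obtain p0 where p0: "p0 holomorphic_on ball 0 1" "\<And>z. z \<in> ball 0 1 \<Longrightarrow> q z = (p0 z)\<^sup>2"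
    using contractible_imp_holomorphic_sqrt[OF q(1)] convex_imp_contractible[OF convex_ball] by metis
  \<comment> \<open>The root \<open>p0\<close> is 1 or -1 at 0; the division selects the branch with
    value 1.\<close>
  define P where "P = (\<lambda>z. p0 z / p0 0)"
  have p00: "(p0 0)\<^sup>2 = 1" using p0(2)[of 0] q(3) by simp
  have P: "P holomorphic_on ball 0 1" "\<And>z. norm z < 1 \<Longrightarrow> f z = z * (P z)\<^sup>2" "P 0 = 1"
    using p0 p00 q unfolding P_def by (auto intro!: holomorphic_intros simp: power_divide)
  have Pnz: "P z \<noteq> 0" if "norm z < 1" for z
  proof
    assume "P z = 0"
    then have "f z = f 0" using P(2)[of z] that f(3) by simp
    then have "z = 0" using inj_onD[OF f(2)] that by simp
    then show False using \<open>P z = 0\<close> P(3) by simp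
  qed
  have dP: "(P has_field_derivative deriv P z) (at z)" if "norm z < 1" for z
    using that by (intro holomorphic_derivI[OF P(1)]) auto
  have holI: "(\<lambda>z. 1 / P z - 1) holomorphic_on ball 0 1"
    using Pnz by (intro holomorphic_intros P) auto
  then obtain k where k: "k holomorphic_on ball 0 1" "\<And>z. norm z < 1 \<Longrightarrow> 1 / P z - 1 = z * k z"
      "deriv (\<lambda>z. 1 / P z - 1) 0 = k 0"
    using Schwarz3[OF holI] P(3) by auto
  have "((\<lambda>z. 1 / P z - 1) has_field_derivative (- deriv P 0)) (at 0)"
    using dP[of 0] by (auto intro!: derivative_eq_intros simp: P(3))
  then have k0: "k 0 = - deriv P 0" using k(3) DERIV_imp_deriv by metis
  have sq: "norm (z\<^sup>2) < 1" if "norm z < 1" for z :: complex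
    using that by (simp add: norm_power power_less_one_iff abs_square_less_1)
  define b where "b = (\<lambda>z. z * k (z\<^sup>2))"
  have b: "b holomorphic_on ball 0 1"
    unfolding b_def
    by (intro holomorphic_intros holomorphic_on_compose_gen[OF _ k(1), unfolded o_def]) (use sq in auto)
  have G: "1 / z + b z = 1 / (z * P (z\<^sup>2))" if "norm z < 1" "z \<noteq> 0" for z
  proof -
    have "1 / P (z\<^sup>2) = 1 + z\<^sup>2 * k (z\<^sup>2)" using k(2)[OF sq[OF that(1)]] by (simp add: algebra_simps)
    then have "1 / (z * P (z\<^sup>2)) = (1 + z\<^sup>2 * k (z\<^sup>2)) / z" by (metis divide_divide_eq_left' mult.commute)
    also have "\<dots> = 1 / z + b z" unfolding b_def using that by (simp add: field_simps power2_eq_square)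
    finally show ?thesis by simp
  qed
  have "inj_on (\<lambda>z. 1 / z + b z) (ball 0 1 - {0})"
  proof (rule inj_onI)
    fix z w assume zw: "z \<in> ball 0 1 - {0}" "w \<in> ball 0 1 - {0}" "1 / z + b z = 1 / w + b w"
    then have eq: "z * P (z\<^sup>2) = w * P (w\<^sup>2)"
      using G[of z] G[of w] Pnz[OF sq[of z]] Pnz[OF sq[of w]] by simp
    have "f (z\<^sup>2) = (z * P (z\<^sup>2))\<^sup>2" "f (w\<^sup>2) = (w * P (w\<^sup>2))\<^sup>2"
      using P(2)[OF sq[of z]] P(2)[OF sq[of w]] zw by (auto simp: power_mult_distrib)
    \<comment> \<open>Only the sign of z is lost by squaring; it is recovered from
      \<open>eq\<close>, where both sides now carry the same nonzero factor
      \<open>P (w\<^sup>2)\<close>.\<close>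
    then have "z\<^sup>2 = w\<^sup>2" using inj_onD[OF f(2), of "z\<^sup>2" "w\<^sup>2"] eq sq[of z] sq[of w] zw by auto
    moreover have "P (w\<^sup>2) \<noteq> 0" using Pnz[OF sq[of w]] zw by simp
    ultimately show "z = w" using eq by simp
  qed
  from area_theorem[OF b this] have "norm (deriv b 0) \<le> 1" .
  moreover have "deriv b 0 = k 0"
  proof -
    have "(k has_field_derivative deriv k 0) (at (0\<^sup>2))"
      using holomorphic_derivI[OF k(1), of 0] by simp
    then have "((\<lambda>z. k (z\<^sup>2)) has_field_derivative deriv k 0 * (2 * 0)) (at 0)"
      by (rule DERIV_chain2) (auto intro!: derivative_eq_intros)
    then have "(b has_field_derivative k 0) (at 0)"
      unfolding b_def by (auto intro!: derivative_eq_intros)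
    then show ?thesis by (rule DERIV_imp_deriv)
  qed
  moreover have "deriv (deriv f) 0 = 4 * deriv P 0"
  proof -
    have "deriv f z = (P z)\<^sup>2 + 2 * z * P z * deriv P z" if "norm z < 1" for z
    proof -
      have "((\<lambda>z. z * (P z)\<^sup>2) has_field_derivative (P z)\<^sup>2 + 2 * z * P z * deriv P z) (at z)"
        using dP[OF that] by (auto intro!: derivative_eq_intros simp: algebra_simps power2_eq_square)
      then have "(f has_field_derivative (P z)\<^sup>2 + 2 * z * P z * deriv P z) (at z)"
        by (rule has_field_derivative_transform_within_open[of _ _ _ "ball 0 1"]) (use that P(2) in auto)
      then show ?thesis by (rule DERIV_imp_deriv)
    qed
    moreover have "((\<lambda>z. (P z)\<^sup>2 + 2 * z * P z * deriv P z) has_field_derivative 4 * deriv P 0) (at 0)"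
      using dP[of 0] holomorphic_derivI[OF holomorphic_deriv[OF P(1)], of 0]
      by (auto intro!: derivative_eq_intros simp: P(3))
    ultimately have "(deriv f has_field_derivative 4 * deriv P 0) (at 0)"
      by (intro has_field_derivative_transform_within_open[of _ _ _ "ball 0 1" "deriv f"]) auto
    then show ?thesis by (rule DERIV_imp_deriv)
  qed
  ultimately show ?thesis using k0 by (simp add: norm_mult)
qed

lemma class_S_deriv_nonzero: "f \<in> class_S \<Longrightarrow> norm z < 1 \<Longrightarrow> deriv f z \<noteq> 0" for f :: "complex \<Rightarrow> complex"
  using holomorphic_injective_imp_regular[of f "ball 0 1" z] by (auto simp: class_S_def)

text \<open>The estimate at \<open>0\<close> is transported to \<open>a\<close> by precomposing with a disk automorphism.\<close>

lemma class_S_pre_schwarzian: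
  fixes f :: "complex \<Rightarrow> complex"
  assumes f: "f \<in> class_S" and a: "norm a < 1"
  shows "norm ((1 - (norm a)\<^sup>2) * (deriv (deriv f) a / deriv f a) - 2 * cnj a) \<le> 4"
proof -
  have fh: "f holomorphic_on ball 0 1" "inj_on f (ball 0 1)"
    using f by (auto simp: class_S_def)
  define c where "c = 1 - (norm a)\<^sup>2"
  have c: "c > 0" using a by (simp add: c_def abs_square_less_1)
  have cc: "complex_of_real c = 1 - a * cnj a" by (simp add: c_def complex_norm_square[symmetric] flip: of_real_power)
  have fa: "deriv f a \<noteq> 0" using class_S_deriv_nonzero[OF f a] .
  \<comment> \<open>The automorphism taking z to (z + a) / (1 + cnj a z), whose value at 0 is a and
    whose derivative there is \<open>c\<close>. Hence division by \<open>c * deriv f a\<close>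
    normalizes \<open>F\<close>, the Koebe transform of \<open>f\<close>, and its second derivative
    at 0 is the quantity to be bounded.\<close>
  define M where "M = Moebius_function 0 (-a)"
  define F where "F = (\<lambda>z. (f (M z) - f a) / (c * deriv f a))"
  have Mball: "norm (M z) < 1" if "norm z < 1" for z
    using Moebius_function_norm_lt_1[of "-a" z 0] that a by (simp add: M_def)
  have Mhol: "M holomorphic_on ball 0 1" unfolding M_def using a by (intro Moebius_function_holomorphic) auto
  have nz: "1 + cnj a * z \<noteq> 0" if "norm z < 1" for z
  proof
    assume "1 + cnj a * z = 0"
    then have "norm (cnj a * z) = 1" by (metis add_eq_0_iff norm_minus_cancel norm_one)
    moreover have "norm (cnj a * z) < 1" using that a by (simp add: norm_mult mult_le_one le_less_trans[OF mult_left_le])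
    ultimately show False by simp
  qed
  have M: "M z = (z + a) / (1 + cnj a * z)" for z by (simp add: M_def Moebius_function_simple)
  have M0: "M 0 = a" by (simp add: M)
  have dM: "(M has_field_derivative c / (1 + cnj a * z)\<^sup>2) (at z)" if "norm z < 1" for z
    unfolding M[abs_def] cc using nz[OF that]
    by (auto intro!: derivative_eq_intros simp: field_simps power2_eq_square)
  have df: "(f has_field_derivative deriv f z) (at z)" "(deriv f has_field_derivative deriv (deriv f) z) (at z)" if "norm z < 1" for z
    using that fh holomorphic_deriv[OF fh(1)] by (auto intro!: holomorphic_derivI)
  have dF: "(F has_field_derivative deriv f (M z) / deriv f a / (1 + cnj a * z)\<^sup>2) (at z)" if "norm z < 1" for z
  proof -
    have "((\<lambda>z. f (M z)) has_field_derivative deriv f (M z) * (c / (1 + cnj a * z)\<^sup>2)) (at z)"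
      by (rule DERIV_chain2[OF df(1)[OF Mball[OF that]] dM[OF that]])
    then have "(F has_field_derivative (deriv f (M z) * (c / (1 + cnj a * z)\<^sup>2) - 0) / (c * deriv f a)) (at z)"
      unfolding F_def by (intro DERIV_cdivide DERIV_diff DERIV_const)
    moreover have "(D * (k / q) - 0) / (k * l) = D / l / q" if "k \<noteq> 0" for D k l q :: complex
      using that by simp
    ultimately show ?thesis using c by (simp add: mult.commute)
  qed
  have "F \<in> class_S"
  proof -
    have "inj_on F (ball 0 1)"
    proof (rule inj_onI)
      fix z w assume zw: "z \<in> ball 0 1" "w \<in> ball 0 1" "F z = F w"
      then have "f (M z) = f (M w)" using c fa by (simp add: F_def)
      then have "M z = M w" using inj_onD[OF fh(2), of "M z" "M w"] Mball zw by simp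
      moreover have "Moebius_function 0 a (M z) = z" if "norm z < 1" for z
        unfolding M_def by (rule Moebius_function_compose[OF refl a that])
      ultimately show "z = w" using zw(1,2) by (metis mem_ball_0)
    qed
    moreover have "F holomorphic_on ball 0 1"
      unfolding F_def using c fa Mball
      by (intro holomorphic_intros holomorphic_on_compose_gen[OF Mhol fh(1), unfolded o_def]) auto
    moreover have "deriv F 0 = 1" using DERIV_imp_deriv[OF dF[of 0]] fa by (simp add: M0)
    ultimately show ?thesis by (simp add: class_S_def F_def M0)
  qed
  from class_S_deriv2_le[OF this] have "norm (deriv (deriv F) 0) \<le> 4" .
  moreover have "deriv (deriv F) 0 = (1 - (norm a)\<^sup>2) * (deriv (deriv f) a / deriv f a) - 2 * cnj a"
  proof -
    have "((\<lambda>z. deriv f (M z)) has_field_derivative deriv (deriv f) (M 0) * (c / (1 + cnj a * 0)\<^sup>2)) (at 0)"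
      by (rule DERIV_chain2[OF df(2)[OF Mball] dM]) auto
    then have "((\<lambda>z. deriv f (M z)) has_field_derivative deriv (deriv f) a * c) (at 0)" by (simp add: M0)
    then have "((\<lambda>z. deriv f (M z) / deriv f a / (1 + cnj a * z)\<^sup>2) has_field_derivative
        c * (deriv (deriv f) a / deriv f a) - 2 * cnj a) (at 0)"
      using fa by (auto intro!: derivative_eq_intros simp: M0 field_simps)
    then have "(deriv F has_field_derivative c * (deriv (deriv f) a / deriv f a) - 2 * cnj a) (at 0)"
      by (rule has_field_derivative_transform_within_open[of _ _ _ "ball 0 1"])
         (use DERIV_imp_deriv[OF dF] in auto)
    then show ?thesis by (simp add: DERIV_imp_deriv c_def)
  qed
  ultimately show ?thesis by simp
qed

text \<open>Along a radius, ln |f'| has derivative Re (u f''/f'), which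
  \<open>class_S_pre_schwarzian\<close> places between (2t - 4)/(1 - t^2) and (2t + 4)/(1 - t^2).
  These are the derivatives of ln (1 - t) - 3 ln (1 + t) and of ln (1 + t) - 3 ln (1 - t).\<close>

theorem koebe_distortion:
  fixes f :: "complex \<Rightarrow> complex"
  assumes f: "f \<in> class_S" and z: "norm z < 1"
  shows "(1 - norm z) / (1 + norm z)^3 \<le> norm (deriv f z)"
    and "norm (deriv f z) \<le> (1 + norm z) / (1 - norm z)^3"
proof -
  have fh: "f holomorphic_on ball 0 1" "deriv f 0 = 1"
    using f by (auto simp: class_S_def)
  obtain u where u: "norm u = 1" "z = of_real (norm z) * u"
  proof (cases "z = 0")
    case True then show ?thesis using that[of 1] by simp
  next
    case False then show ?thesis using that[of "z / of_real (norm z)"] by (simp add: norm_divide)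
  qed
  define r where "r = norm z"
  have r: "0 \<le> r" "r < 1" using z by (auto simp: r_def)
  define N where "N = (\<lambda>t. ln (norm (deriv f (of_real t * u))))"
  define R where "R = (\<lambda>t. Re (u * deriv (deriv f) (of_real t * u) / deriv f (of_real t * u)))"
  have nz: "deriv f (of_real t * u) \<noteq> 0" if "0 \<le> t" "t < 1" for t
    using that u by (intro class_S_deriv_nonzero[OF f]) (simp add: norm_mult)
  have dN: "(N has_real_derivative R t) (at t)" if t: "0 \<le> t" "t < 1" for t
  proof -
    let ?D = "deriv f (of_real t * u)"
    have "(deriv f has_field_derivative deriv (deriv f) (of_real t * u)) (at (of_real t * u))"
      using t u by (intro holomorphic_derivI[OF holomorphic_deriv[OF fh(1)]]) (auto simp: norm_mult)
    moreover have "((\<lambda>t. of_real t * u) has_vector_derivative u) (at t)"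
      by (auto intro!: derivative_eq_intros simp: has_vector_derivative_def scaleR_conv_of_real)
    ultimately have "((\<lambda>t. deriv f (of_real t * u)) has_vector_derivative u * deriv (deriv f) (of_real t * u)) (at t)"
      using field_vector_diff_chain_at[of "\<lambda>t. of_real t * u"] by (simp add: o_def)
    then have "((\<lambda>t. norm (deriv f (of_real t * u))) has_derivative (\<lambda>h. (h *\<^sub>R (u * deriv (deriv f) (of_real t * u))) \<bullet> sgn ?D)) (at t)"
      unfolding has_vector_derivative_def using has_derivative_norm[OF nz[OF t]] has_derivative_compose
      by fastforce
    moreover have "(\<lambda>h. (h *\<^sub>R (u * deriv (deriv f) (of_real t * u))) \<bullet> sgn ?D) = (*) ((u * deriv (deriv f) (of_real t * u)) \<bullet> sgn ?D)"
      by (auto simp: mult.commute)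
    ultimately have "((\<lambda>t. norm (deriv f (of_real t * u))) has_real_derivative (u * deriv (deriv f) (of_real t * u)) \<bullet> sgn ?D) (at t)"
      by (simp add: has_field_derivative_def)
    then have "(N has_real_derivative 1 / norm ?D * ((u * deriv (deriv f) (of_real t * u)) \<bullet> sgn ?D)) (at t)"
      unfolding N_def by (intro DERIV_chain2[OF DERIV_ln_divide]) (use nz[OF t] in auto)
    moreover have "1 / norm D * (w \<bullet> sgn D) = Re (w / D)" for w D :: complex
    proof -
      have "Re (w / D) = (w \<bullet> D) / (norm D)\<^sup>2"
        by (simp add: Re_divide inner_complex_def cmod_power2)
      then show ?thesis by (simp add: sgn_div_norm power2_eq_square divide_simps)
    qed
    ultimately show ?thesis unfolding R_def by simp
  qed
  have R: "\<bar>(1 - t\<^sup>2) * R t - 2 * t\<bar> \<le> 4" if t: "0 \<le> t" "t < 1" for t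
  proof -
    let ?a = "of_real t * u" and ?X = "deriv (deriv f) (of_real t * u) / deriv f (of_real t * u)"
    have a: "norm ?a = t" using u t by (simp add: norm_mult)
    have uu: "u * cnj u = 1" using complex_norm_square[of u] u by simp
    \<comment> \<open>The factor u makes \<open>u * cnj ?a\<close> the real number t, so that taking
      real parts keeps the term 2 t exactly.\<close>
    have "norm (u * ((1 - t\<^sup>2) * ?X - 2 * cnj ?a)) \<le> 4"
      using class_S_pre_schwarzian[OF f, of ?a] a t u by (simp add: norm_mult)
    also have "u * ((1 - t\<^sup>2) * ?X - 2 * cnj ?a) = of_real (1 - t\<^sup>2) * (u * ?X) - of_real (2 * t) * (u * cnj u)"
      by (simp add: algebra_simps)
    also have "\<dots> = of_real (1 - t\<^sup>2) * (u * ?X) - of_real (2 * t)" by (simp only: uu mult_1_right)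
    finally have "\<bar>Re (of_real (1 - t\<^sup>2) * (u * ?X) - of_real (2 * t))\<bar> \<le> 4"
      using abs_Re_le_cmod order.trans by blast
    moreover have "Re (of_real c * w - of_real d) = c * Re w - d" for c d w by simp
    ultimately have "\<bar>(1 - t\<^sup>2) * Re (u * ?X) - 2 * t\<bar> \<le> 4" by metis
    then show ?thesis by (simp add: R_def)
  qed
  have exp_ln_diff: "exp (ln x - 3 * ln y) = x / y^3" if "x > 0" "y > 0" for x y :: real
    using that exp_of_nat_mult[of 3 "ln y"] by (simp add: exp_diff)
  have N0: "N 0 = 0" by (simp add: N_def fh)
  have Nr: "exp (N r) = norm (deriv f z)" using nz[OF r] u by (simp add: N_def r_def flip: u(2))
  have "N r - (ln (1 + r) - 3 * ln (1 - r)) \<le> N 0 - (ln (1 + 0) - 3 * ln (1 - 0))"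
  proof (rule DERIV_nonpos_imp_nonincreasing[OF r(1)])
    fix t assume t: "0 \<le> t" "t \<le> r"
    then have t1: "t < 1" using r by simp
    have c: "0 < 1 - t\<^sup>2" using t t1 by (simp add: abs_square_less_1)
    have "((\<lambda>t. N t - (ln (1 + t) - 3 * ln (1 - t))) has_real_derivative R t - (4 + 2 * t) / (1 - t\<^sup>2)) (at t)"
      using t t1 c by (auto intro!: derivative_eq_intros dN simp: divide_simps) (simp add: algebra_simps power2_eq_square)
    moreover have "R t \<le> (4 + 2 * t) / (1 - t\<^sup>2)"
      using R[OF t(1) t1] c by (simp add: pos_le_divide_eq mult.commute)
    ultimately show "\<exists>y. ((\<lambda>t. N t - (ln (1 + t) - 3 * ln (1 - t))) has_real_derivative y) (at t) \<and> y \<le> 0"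
      by force
  qed
  then have "exp (N r) \<le> exp (ln (1 + r) - 3 * ln (1 - r))" using N0 by simp
  also have "\<dots> = (1 + r) / (1 - r)^3"
    using r by (simp add: exp_ln_diff)
  finally show "norm (deriv f z) \<le> (1 + norm z) / (1 - norm z)^3" using Nr by (simp add: r_def)
  have "N 0 - (ln (1 - 0) - 3 * ln (1 + 0)) \<le> N r - (ln (1 - r) - 3 * ln (1 + r))"
  proof (rule DERIV_nonneg_imp_nondecreasing[OF r(1)])
    fix t assume t: "0 \<le> t" "t \<le> r"
    then have t1: "t < 1" using r by simp
    have c: "0 < 1 - t\<^sup>2" using t t1 by (simp add: abs_square_less_1)
    have "((\<lambda>t. N t - (ln (1 - t) - 3 * ln (1 + t))) has_real_derivative R t - (2 * t - 4) / (1 - t\<^sup>2)) (at t)"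
      using t t1 c by (auto intro!: derivative_eq_intros dN simp: divide_simps) (simp add: algebra_simps power2_eq_square)
    moreover have "(2 * t - 4) / (1 - t\<^sup>2) \<le> R t"
      using R[OF t(1) t1] c by (simp add: pos_divide_le_eq mult.commute)
    ultimately show "\<exists>y. ((\<lambda>t. N t - (ln (1 - t) - 3 * ln (1 + t))) has_real_derivative y) (at t) \<and> y \<ge> 0"
      by force
  qed
  then have "exp (ln (1 - r) - 3 * ln (1 + r)) \<le> exp (N r)" using N0 by simp
  moreover have "exp (ln (1 - r) - 3 * ln (1 + r)) = (1 - r) / (1 + r)^3"
    using r by (simp add: exp_ln_diff)
  ultimately have "(1 - r) / (1 + r)^3 \<le> exp (N r)" by (simp only:)
  then show "(1 - norm z) / (1 + norm z)^3 \<le> norm (deriv f z)" using Nr by (simp add: r_def)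
qed

subsection \<open>The harmonic Koebe function\<close>

text \<open>The analytic parts of the shear of the Koebe function with dilatation z: h - g = z / (1
  - z)^2 and g' = z h'. This dilatation is an extremal case of the Schwarz lemma.\<close>

definition koebe_h :: "complex \<Rightarrow> complex" where
  "koebe_h z = (z - 1/2 * z^2 + 1/6 * z^3) / (1 - z)^3"

definition koebe_g :: "complex \<Rightarrow> complex" where
  "koebe_g z = (1/2 * z^2 + 1/6 * z^3) / (1 - z)^3"

lemma koebe_h_deriv:
  assumes "z \<noteq> 1" shows "(koebe_h has_field_derivative (1 + z) / (1 - z)^4) (at z)"
proof -
  have z: "1 - z \<noteq> 0" using assms by simp
  have "(koebe_h has_field_derivative ((1 - z + z\<^sup>2 / 2) * (1 - z)^3 - (z - 1/2 * z^2 + 1/6 * z^3) * (- (3 * (1 - z)\<^sup>2))) / ((1 - z)^3 * (1 - z)^3)) (at z)"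
    unfolding koebe_h_def[abs_def] using z
    by (auto intro!: derivative_eq_intros simp: power2_eq_square)
  also have "((1 - z + z\<^sup>2 / 2) * (1 - z)^3 - (z - 1/2 * z^2 + 1/6 * z^3) * (- (3 * (1 - z)\<^sup>2))) = (1 - z)\<^sup>2 * (1 + z)"
    by (simp add: field_simps power2_eq_square power3_eq_cube)
  also have "(1 - z)\<^sup>2 * (1 + z) / ((1 - z)^3 * (1 - z)^3) = (1 + z) / (1 - z)^4"
    using z by (simp add: divide_simps power_numeral_reduce)
  finally show ?thesis .
qed

lemma koebe_g_deriv:
  assumes "z \<noteq> 1" shows "(koebe_g has_field_derivative z * (1 + z) / (1 - z)^4) (at z)"
proof -
  have z: "1 - z \<noteq> 0" using assms by simp
  have "(koebe_g has_field_derivative ((z + z\<^sup>2 / 2) * (1 - z)^3 - (1/2 * z^2 + 1/6 * z^3) * (- (3 * (1 - z)\<^sup>2))) / ((1 - z)^3 * (1 - z)^3)) (at z)"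
    unfolding koebe_g_def[abs_def] using z
    by (auto intro!: derivative_eq_intros simp: power2_eq_square)
  also have "((z + z\<^sup>2 / 2) * (1 - z)^3 - (1/2 * z^2 + 1/6 * z^3) * (- (3 * (1 - z)\<^sup>2))) = (1 - z)\<^sup>2 * (z * (1 + z))"
    by (simp add: field_simps power2_eq_square power3_eq_cube)
  also have "(1 - z)\<^sup>2 * (z * (1 + z)) / ((1 - z)^3 * (1 - z)^3) = z * (1 + z) / (1 - z)^4"
    using z by (simp add: divide_simps power_numeral_reduce)
  finally show ?thesis .
qed

lemma koebe_h_minus_g: "z \<noteq> 1 \<Longrightarrow> koebe_h z - koebe_g z = z / (1 - z)\<^sup>2"
proof -
  assume "z \<noteq> 1"
  have "koebe_h z - koebe_g z = (z * (1 - z)) / (1 - z)^3"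
    unfolding koebe_h_def koebe_g_def by (simp add: diff_divide_distrib[symmetric] algebra_simps power2_eq_square)
  then show ?thesis using \<open>z \<noteq> 1\<close> by (simp add: power2_eq_square power3_eq_cube)
qed

text \<open>The sum h + g gives the real part of the harmonic Koebe function in the disk and its
  value on the real axis. The cubes in the growth bounds are this cube of the Cayley
  transform.\<close>

lemma koebe_h_plus_g:
  assumes "z \<noteq> 1" shows "koebe_h z + koebe_g z = (((1 + z) / (1 - z))^3 - 1) / 6"
proof -
  have z: "1 - z \<noteq> 0" using assms by simp
  have "koebe_h z + koebe_g z = (z + z^3 / 3) / (1 - z)^3"
    unfolding koebe_h_def koebe_g_def by (simp add: add_divide_distrib[symmetric] algebra_simps)
  also have "z + z^3 / 3 = ((1 + z)^3 - (1 - z)^3) / 6"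
    by (simp add: field_simps power3_eq_cube)
  finally show ?thesis using z by (simp add: power_divide diff_divide_distrib)
qed

lemma inj_on_koebe: "inj_on (\<lambda>z. z / (1 - z)\<^sup>2 :: complex) (ball 0 1)"
proof (rule inj_onI)
  fix z w :: complex assume zw: "z \<in> ball 0 1" "w \<in> ball 0 1" "z / (1 - z)\<^sup>2 = w / (1 - w)\<^sup>2"
  have "1 - z \<noteq> 0" "1 - w \<noteq> 0" using zw by auto
  then have "z * (1 - w)\<^sup>2 = w * (1 - z)\<^sup>2" using zw(3) by (simp add: frac_eq_eq)
  then have "(z - w) * (1 - z * w) = 0" by (simp add: algebra_simps power2_eq_square)
  moreover have "z * w \<noteq> 1"
  proof
    assume "z * w = 1"
    then have "norm z * norm w = 1" by (metis norm_mult norm_one)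
    moreover have "norm z * norm w < 1 * 1"
      using zw by (intro mult_strict_mono) auto
    ultimately show False by simp
  qed
  ultimately show "z = w" by simp
qed

text \<open>
  In terms of \<open>\<zeta> = (1 + z) / (1 - z) = x + \<i> y\<close> with \<open>x > 0\<close>, the real part of \<open>6 K + 1\<close> is
  \<open>x^3 - 3 x y^2\<close> and the imaginary part of \<open>2 K\<close> is \<open>x y\<close>. For a fixed value of \<open>x y\<close> the former
  increases with \<open>x\<close>.
\<close>

lemma inj_on_harmonic_koebe: "inj_on harmonic_koebe (ball 0 1)"
proof (rule inj_onI)
  fix z w :: complex assume zw: "z \<in> ball 0 1" "w \<in> ball 0 1" "harmonic_koebe z = harmonic_koebe w"
  define C where "C = (\<lambda>z::complex. (1 + z) / (1 - z))"
  have C: "Re (C z) > 0" "Re (harmonic_koebe z) = ((Re (C z))^3 - 3 * Re (C z) * (Im (C z))\<^sup>2 - 1) / 6"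
    "Im (harmonic_koebe z) = Re (C z) * Im (C z) / 2" if "norm z < 1" for z
  proof -
    have z1: "z \<noteq> 1" using that by auto
    then have z: "1 - z \<noteq> 0" by simp
    have "Re ((1 + z) * cnj (1 - z)) = 1 - (norm z)\<^sup>2"
      unfolding cmod_power2 by (simp add: power2_eq_square algebra_simps)
    moreover have "1 - (norm z)\<^sup>2 > 0" using that by (simp add: abs_square_less_1)
    ultimately show "Re (C z) > 0"
      unfolding C_def using z by (simp add: complex_div_cnj[of "1+z"] del: complex_cnj_diff complex_cnj_one)
    have K: "harmonic_koebe z = koebe_h z + cnj (koebe_g z)"
      by (simp add: harmonic_koebe_def koebe_h_def koebe_g_def)
    have "Re (harmonic_koebe z) = Re (koebe_h z + koebe_g z)" "Im (harmonic_koebe z) = Im (koebe_h z - koebe_g z)"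
      by (simp_all add: K)
    then have 1: "Re (harmonic_koebe z) = Re (((C z)^3 - 1) / 6)" "Im (harmonic_koebe z) = Im (((C z)\<^sup>2 - 1) / 4)"
    proof -
      have "(C z)\<^sup>2 - 1 = ((1 + z)\<^sup>2 - (1 - z)\<^sup>2) / (1 - z)\<^sup>2"
        using z by (simp add: C_def power_divide diff_divide_distrib)
      also have "(1 + z)\<^sup>2 - (1 - z)\<^sup>2 = 4 * z"
        by (simp add: power2_eq_square algebra_simps)
      finally have "((C z)\<^sup>2 - 1) / 4 = z / (1 - z)\<^sup>2" by simp
      then show "Im (harmonic_koebe z) = Im (((C z)\<^sup>2 - 1) / 4)"
        using koebe_h_minus_g[OF z1] \<open>Im (harmonic_koebe z) = _\<close> by simp
      show "Re (harmonic_koebe z) = Re (((C z)^3 - 1) / 6)"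
        unfolding \<open>Re (harmonic_koebe z) = _\<close> koebe_h_plus_g[OF z1] C_def ..
    qed
    show "Re (harmonic_koebe z) = ((Re (C z))^3 - 3 * Re (C z) * (Im (C z))\<^sup>2 - 1) / 6"
      unfolding 1 by (simp add: power3_eq_cube power2_eq_square algebra_simps)
    show "Im (harmonic_koebe z) = Re (C z) * Im (C z) / 2"
      unfolding 1 by (simp add: power2_eq_square algebra_simps)
  qed
  obtain x y u v where xy: "C z = Complex x y" "C w = Complex u v" by (metis complex.exhaust)
  have pos: "x > 0" "u > 0" using C(1)[of z] C(1)[of w] zw xy by auto
  have im: "x * y = u * v" using C(3)[of z] C(3)[of w] zw xy by simp
  have re: "x^3 - 3 * x * y\<^sup>2 = u^3 - 3 * u * v\<^sup>2"
    using C(2)[of z] C(2)[of w] zw xy by simp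
  have mono: "x^3 - 3 * x * y\<^sup>2 < u^3 - 3 * u * v\<^sup>2" if "0 < x" "x < u" "x * y = u * v" for x y u v :: real
  proof -
    have "x^3 < u^3" using that by (intro power_strict_mono) auto
    \<comment> \<open>With x y^2 written as |x y| |y|, it suffices that for a fixed product a larger
      first coordinate does not allow a larger modulus of the second.\<close>
    moreover have "u * v\<^sup>2 \<le> x * y\<^sup>2"
    proof -
      have "\<bar>v\<bar> \<le> \<bar>y\<bar>"
      proof (rule ccontr)
        assume "\<not> ?thesis"
        then have "x * \<bar>y\<bar> < u * \<bar>v\<bar>" using that by (intro mult_strict_mono) auto
        moreover have "x * \<bar>y\<bar> = u * \<bar>v\<bar>" using that by (metis abs_mult abs_of_pos order.strict_trans)
        ultimately show False by simp
      qed
      then have "\<bar>u * v\<bar> * \<bar>v\<bar> \<le> \<bar>u * v\<bar> * \<bar>y\<bar>" by (intro mult_left_mono) auto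
      then have "\<bar>u * v\<bar> * \<bar>v\<bar> \<le> \<bar>x * y\<bar> * \<bar>y\<bar>" using that by simp
      moreover have "a * b\<^sup>2 = \<bar>a * b\<bar> * \<bar>b\<bar>" if "0 < a" for a b :: real
        using that by (simp add: abs_mult power2_eq_square mult.assoc)
      ultimately show ?thesis using that by simp
    qed
    ultimately show ?thesis by simp
  qed
  have "x = u" using mono[of x u y v] mono[of u x v y] pos im re by (metis less_irrefl linorder_less_linear)
  moreover have "y = v" using im pos \<open>x = u\<close> by simp
  ultimately have "C z = C w" using xy by simp
  moreover have "z \<noteq> 1" "w \<noteq> 1" using zw by auto
  ultimately show "z = w" unfolding C_def by (simp add: frac_eq_eq algebra_simps)
qed

text \<open>Because 1/e = \<open>cnj e\<close>, the outer factor of the rotation enters the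
  conjugated part as e: the new pair is h(e z)/e and e g(e z). Its dilatation is e^3 z, still of
  modulus |z|.\<close>

lemma rotation_harmonic_koebe_in_class: "rotation \<alpha> harmonic_koebe \<in> class_SH0_S"
proof -
  define e where "e = exp (\<i> * complex_of_real \<alpha>)"
  have e: "norm e = 1" "e \<noteq> 0" "cnj e = 1 / e" "exp (- (\<i> * complex_of_real \<alpha>)) = 1 / e"
    by (simp_all add: e_def exp_minus divide_inverse exp_cnj)
  define h where "h = (\<lambda>z. koebe_h (e * z) / e)"
  define g where "g = (\<lambda>z. e * koebe_g (e * z))"
  have ez: "norm (e * z) = norm z" for z using e by (simp add: norm_mult)
  have ne: "e * z \<noteq> 1" if "norm z < 1" for z using ez[of z] that by auto
  have de: "((\<lambda>z. e * z) has_field_derivative e) (at z)" for z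
    by (auto intro!: derivative_eq_intros)
  have dh: "(h has_field_derivative (1 + e * z) / (1 - e * z)^4) (at z)" if "norm z < 1" for z
    using DERIV_cdivide[OF DERIV_chain2[OF koebe_h_deriv[OF ne[OF that]] de], of e] e
    unfolding h_def by simp
  have dg: "(g has_field_derivative e\<^sup>2 * ((e * z) * (1 + e * z) / (1 - e * z)^4)) (at z)" if "norm z < 1" for z
    using DERIV_cmult[OF DERIV_chain2[OF koebe_g_deriv[OF ne[OF that]] de], of e]
    unfolding g_def by (simp add: power2_eq_square algebra_simps)
  let ?F = "rotation \<alpha> harmonic_koebe"
  have F: "?F z = h z + cnj (g z)" for z
  proof -
    have "harmonic_koebe (e * z) = koebe_h (e * z) + cnj (koebe_g (e * z))"
      by (simp add: harmonic_koebe_def koebe_h_def koebe_g_def)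
    then have "?F z = 1 / e * (koebe_h (e * z) + cnj (koebe_g (e * z)))"
      unfolding rotation_def e(4) by (simp add: e_def)
    then show ?thesis by (simp add: h_def g_def e(3) algebra_simps)
  qed
  have decomp: "harmonic_decomp ?F h g"
    unfolding harmonic_decomp_def
  proof (intro conjI ballI)
    show "h holomorphic_on ball 0 1" "g holomorphic_on ball 0 1"
      unfolding holomorphic_on_open[OF open_ball] using dh dg by (meson mem_ball_0)+
    show "h 0 = 0" "g 0 = 0" by (simp_all add: h_def g_def koebe_h_def koebe_g_def)
    show "deriv h 0 = 1" using DERIV_imp_deriv[OF dh[of 0]] by simp
  qed (rule F)
  have jac: "decomp_jacobian h g z > 0" if "z \<in> ball 0 1" for z
  proof -
    have nz: "norm z < 1" using that by simp
    let ?k = "(1 + e * z) / (1 - e * z)^4"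
    have "e * z \<noteq> - 1" using ez[of z] nz by (metis less_irrefl norm_minus_cancel norm_one)
    then have "?k \<noteq> 0" using ne[OF nz] by (simp add: add_eq_0_iff)
    then have k: "norm ?k > 0" by (rule zero_less_norm_iff[THEN iffD2])
    have "deriv g z = e\<^sup>2 * (e * z) * ?k" using DERIV_imp_deriv[OF dg[OF nz]] by simp
    then have "norm (deriv g z) = norm z * norm ?k"
      using e ez by (simp only: norm_mult norm_power) simp
    moreover have "norm (deriv h z) = norm ?k" using DERIV_imp_deriv[OF dh[OF nz]] by simp
    moreover have "norm z * norm ?k < norm ?k" using nz k by simp
    ultimately show ?thesis unfolding decomp_jacobian_def
      by (simp add: power_strict_mono)
  qed
  have inj: "inj_on ?F (ball 0 1)"
  proof (rule inj_onI)
    fix z w assume zw: "z \<in> ball 0 1" "w \<in> ball 0 1" "?F z = ?F w"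
    then have "harmonic_koebe (e * z) = harmonic_koebe (e * w)" by (simp add: rotation_def e_def)
    then have "e * z = e * w" using inj_onD[OF inj_on_harmonic_koebe, of "e * z" "e * w"] ez zw by simp
    then show "z = w" using e by simp
  qed
  have g0: "deriv g 0 = 0" using DERIV_imp_deriv[OF dg[of 0]] by simp
  \<comment> \<open>To recover a multiple of h - g for the original pair, exp (\<i> \<theta>) e must
    equal -1/e, which holds for \<theta> = pi - 2 \<alpha>. The shear is then a rotated Koebe
    function.\<close>
  have "(\<lambda>z. h z + exp (\<i> * of_real (pi - 2 * \<alpha>)) * g z) \<in> class_S"
  proof -
    have E: "exp (\<i> * of_real (pi - 2 * \<alpha>)) = - 1 / e\<^sup>2"
      by (simp add: e_def right_diff_distrib exp_diff exp_double[symmetric] mult_ac)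
    have eq: "h z + exp (\<i> * of_real (pi - 2 * \<alpha>)) * g z = (koebe_h (e * z) - koebe_g (e * z)) / e" for z
      unfolding E h_def g_def using e(2) by (simp add: field_simps power2_eq_square)
    let ?\<phi> = "\<lambda>z. h z + exp (\<i> * of_real (pi - 2 * \<alpha>)) * g z"
    have hol: "h holomorphic_on ball 0 1" "g holomorphic_on ball 0 1"
      using decomp by (auto simp: harmonic_decomp_def)
    have "inj_on ?\<phi> (ball 0 1)"
    proof (rule inj_onI)
      fix z w assume zw: "z \<in> ball 0 1" "w \<in> ball 0 1" "?\<phi> z = ?\<phi> w"
      then have "koebe_h (e * z) - koebe_g (e * z) = koebe_h (e * w) - koebe_g (e * w)"
        unfolding eq using e by simp
      then have "(e * z) / (1 - e * z)\<^sup>2 = (e * w) / (1 - e * w)\<^sup>2"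
        using koebe_h_minus_g[OF ne] zw by simp
      then have "e * z = e * w" using inj_onD[OF inj_on_koebe, of "e * z" "e * w"] ez zw by simp
      then show "z = w" using e by simp
    qed
    moreover have "deriv ?\<phi> 0 = 1"
    proof (rule DERIV_imp_deriv)
      have "(h has_field_derivative 1) (at 0)" "(g has_field_derivative 0) (at 0)"
        using dh[of 0] dg[of 0] by simp_all
      from DERIV_add[OF this(1) DERIV_cmult[OF this(2)]]
      show "(?\<phi> has_field_derivative 1) (at 0)" by (simp only: mult_zero_right add_0_right)
    qed
    moreover have "?\<phi> holomorphic_on ball 0 1" by (intro holomorphic_intros hol)
    ultimately show ?thesis by (simp add: class_S_def h_def g_def koebe_h_def koebe_g_def)
  qed
  then show ?thesis
    using decomp jac inj g0
    unfolding class_SH0_S_def class_SH0_def class_SH_def class_H_def sense_preserving_def by blast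
qed

text \<open>The extremal points are r/e for the upper and -r/e for the lower bound, where e = exp
  (\<i> \<alpha>). There the rotation reduces, up to the factor 1/e, to the value at a real point x,
  which is (((1+x)/(1-x))^3 - 1)/6; it is negative or zero for x = -r.\<close>

lemma norm_rotation_harmonic_koebe:
  assumes "0 \<le> r" "r < 1"
  shows "\<exists>z. norm z = r \<and> norm (rotation \<alpha> harmonic_koebe z) = 1/6 * (1 - ((1 - r) / (1 + r))^3)"
    and "\<exists>z. norm z = r \<and> norm (rotation \<alpha> harmonic_koebe z) = 1/6 * (((1 + r) / (1 - r))^3 - 1)"
proof -
  define e where "e = exp (\<i> * complex_of_real \<alpha>)"
  have e: "norm e = 1" "e \<noteq> 0" "exp (- (\<i> * complex_of_real \<alpha>)) = 1 / e"
    by (simp_all add: e_def exp_minus divide_inverse)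
  have K: "harmonic_koebe (of_real x) = of_real (1/6 * (((1 + x) / (1 - x))^3 - 1))" if "x \<noteq> 1" for x
  proof -
    have "koebe_g (of_real x) = of_real ((1/2 * x^2 + 1/6 * x^3) / (1 - x)^3)"
      by (simp add: koebe_g_def)
    then have "cnj (koebe_g (of_real x)) = koebe_g (of_real x)" by (metis complex_cnj_complex_of_real)
    then have "harmonic_koebe (of_real x) = koebe_h (of_real x) + koebe_g (of_real x)"
      by (simp add: harmonic_koebe_def koebe_h_def koebe_g_def)
    also have "\<dots> = of_real (1/6 * (((1 + x) / (1 - x))^3 - 1))"
      using koebe_h_plus_g[of "of_real x"] that by simp
    finally show ?thesis .
  qed
  have rot: "norm (of_real x / e) = \<bar>x\<bar>"
    "norm (rotation \<alpha> harmonic_koebe (of_real x / e)) = \<bar>1/6 * (((1 + x) / (1 - x))^3 - 1)\<bar>" if "x \<noteq> 1" for x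
  proof -
    show "norm (of_real x / e) = \<bar>x\<bar>" using e by (simp add: norm_divide)
    have "rotation \<alpha> harmonic_koebe (of_real x / e) = harmonic_koebe (of_real x) / e"
      using e unfolding rotation_def e_def[symmetric] by simp
    then show "norm (rotation \<alpha> harmonic_koebe (of_real x / e)) = \<bar>1/6 * (((1 + x) / (1 - x))^3 - 1)\<bar>"
      using e by (simp only: K[OF that] norm_divide norm_of_real div_by_1)
  qed
  have "1 \<le> ((1 + r) / (1 - r))^3" using assms by (intro one_le_power) (simp add: field_simps)
  then show "\<exists>z. norm z = r \<and> norm (rotation \<alpha> harmonic_koebe z) = 1/6 * (((1 + r) / (1 - r))^3 - 1)"
    using rot[of r] assms by (intro exI[of _ "of_real r / e"]) auto
  have "((1 - r) / (1 + r))^3 \<le> 1" using assms by (intro power_le_one) auto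
  then show "\<exists>z. norm z = r \<and> norm (rotation \<alpha> harmonic_koebe z) = 1/6 * (1 - ((1 - r) / (1 + r))^3)"
    using rot[of "-r"] assms by (intro exI[of _ "of_real (-r) / e"]) auto
qed

subsection \<open>Growth of harmonic maps\<close>

lemma has_derivative_norm_line:
  fixes F :: "complex \<Rightarrow> complex"
  assumes "(F has_derivative F') (at y)" "F y \<noteq> 0"
  shows "((\<lambda>t. norm (F (y + of_real t * v))) has_real_derivative F' v \<bullet> sgn (F y)) (at 0)"
proof -
  have "((\<lambda>t. y + of_real t * v) has_derivative (\<lambda>t. of_real t * v)) (at (0::real))"
    by (auto intro!: derivative_eq_intros)
  from has_derivative_compose[OF this, of F F'] assms(1)
  have "((\<lambda>t. F (y + of_real t * v)) has_derivative (\<lambda>t. F' (of_real t * v))) (at 0)"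
    by simp
  from has_derivative_compose[OF this, of norm "\<lambda>w. w \<bullet> sgn (F y)"] has_derivative_norm[OF assms(2)]
  have "((\<lambda>t. norm (F (y + of_real t * v))) has_derivative (\<lambda>t. F' (of_real t * v) \<bullet> sgn (F y))) (at 0)"
    by simp
  moreover have "F' (of_real t * v) = t *\<^sub>R F' v" for t
    using linear_scale[OF has_derivative_linear[OF assms(1)], of t v] by (simp only: scaleR_conv_of_real)
  then have "F' (of_real t * v) \<bullet> sgn (F y) = F' v \<bullet> sgn (F y) * t" for t
    by (simp only: inner_scaleR_left mult.commute)
  ultimately show ?thesis by (simp add: has_field_derivative_def)
qed

text \<open>
  This replaces the integration along the preimage of a segment, which would require differentiating the inverse of \<open>F\<close>.
  The minimum of \<open>norm (F z) - c * \<psi> (norm z)\<close> on a sublevel set of \<open>norm F\<close> can only be attained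
  at \<open>0\<close>: elsewhere one can move in the direction in which \<open>F\<close> runs straight towards \<open>0\<close>.
\<close>

lemma harmonic_growth_in_disc:
  fixes F h g :: "complex \<Rightarrow> complex" and \<psi> \<psi>' :: "real \<Rightarrow> real"
  assumes hg: "h holomorphic_on ball 0 1" "g holomorphic_on ball 0 1"
    and F: "F = (\<lambda>z. h z + cnj (g z))" and inj: "inj_on F (ball 0 1)" and F0: "F 0 = 0"
    and \<psi>: "\<And>t. 0 \<le> t \<Longrightarrow> t < 1 \<Longrightarrow> (\<psi> has_real_derivative \<psi>' t) (at t)" "\<psi> 0 = 0"
    and \<psi>'_pos: "\<And>t. 0 \<le> t \<Longrightarrow> t < 1 \<Longrightarrow> 0 < \<psi>' t"
    and le: "\<And>z. norm z < 1 \<Longrightarrow> \<psi>' (norm z) \<le> norm (deriv h z) - norm (deriv g z)"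
    and r: "r < 1" and m: "\<And>z. norm z = r \<Longrightarrow> m \<le> norm (F z)"
    and c: "0 < c" "c < 1" and z: "norm z \<le> r" "norm (F z) < m"
  shows "c * \<psi> (norm z) \<le> norm (F z)"
proof -
  have contF: "continuous_on (ball 0 1) F"
    unfolding F by (intro continuous_intros holomorphic_on_imp_continuous_on hg)
  \<comment> \<open>Passing to the sublevel set keeps the minimizer off the circle |y| = r, where
    |F| >= m > |F z|, so that there is room to move in every direction.\<close>
  define K where "K = {y \<in> cball 0 r. norm (F y) \<le> norm (F z)}"
  define M where "M = (\<lambda>y. norm (F y) - c * \<psi> (norm y))"
  have K1: "norm y < 1" if "y \<in> K" for y using that r by (simp add: K_def)
  have "compact K"
  proof -
    have "continuous_on (cball 0 r) F" by (rule continuous_on_subset[OF contF]) (use r in auto)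
    then have "closed (cball 0 r \<inter> F -` cball 0 (norm (F z)))"
      by (intro continuous_closed_preimage) auto
    moreover have "cball 0 r \<inter> F -` cball 0 (norm (F z)) = K" by (auto simp: K_def)
    moreover have "bounded K" by (rule bounded_subset[OF bounded_cball[of 0 r]]) (auto simp: K_def)
    ultimately show ?thesis by (simp add: compact_eq_bounded_closed)
  qed
  moreover have "z \<in> K" using z by (simp add: K_def)
  moreover have "continuous_on K M"
  proof -
    have "continuous_on {0..<1} \<psi>"
      by (meson DERIV_isCont continuous_at_imp_continuous_on \<psi>(1) atLeastLessThan_iff)
    then have "continuous_on K (\<lambda>y. \<psi> (norm y))"
      by (rule continuous_on_compose2) (use K1 in \<open>auto intro!: continuous_intros\<close>)
    moreover have "continuous_on K F" by (rule continuous_on_subset[OF contF]) (use K1 in auto)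
    ultimately show ?thesis unfolding M_def by (intro continuous_intros)
  qed
  ultimately obtain y where y: "y \<in> K" "\<And>x. x \<in> K \<Longrightarrow> M y \<le> M x"
    using continuous_attains_inf[of K M] by blast
  have "y = 0"
  proof (rule ccontr)
    assume y0: "y \<noteq> 0"
    have y1: "norm y < 1" using K1 y by blast
    have yr: "norm y < r" using y(1) m[of y] z(2) unfolding K_def by (cases "norm y = r") auto
    have Fy: "F y \<noteq> 0" using inj_onD[OF inj, of y 0] F0 y0 y1 by auto
    define p q \<tau> where "p = deriv h y" and "q = deriv g y" and "\<tau> = - sgn (F y)"
    define J where "J = (norm p)\<^sup>2 - (norm q)\<^sup>2"
    \<comment> \<open>The real-linear differential of \<open>F\<close> at \<open>y\<close> is
      inverted explicitly: along \<open>v\<close> the value of \<open>F\<close> moves with velocity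
      \<tau>, at unit speed towards 0.\<close>
    define v where "v = (cnj p * \<tau> - cnj q * cnj \<tau>) / of_real J"
    have pq: "\<psi>' (norm y) \<le> norm p - norm q" "0 < \<psi>' (norm y)"
      using le[OF y1] \<psi>'_pos[of "norm y"] y1 by (auto simp: p_def q_def)
    then have "norm q < norm p" by linarith
    then have J: "J > 0" unfolding J_def by (simp add: power_strict_mono)
    have nt: "norm \<tau> = 1" using Fy by (simp add: \<tau>_def norm_sgn)
    have v: "p * v + cnj (q * v) = \<tau>"
    proof -
      have "p * v + cnj (q * v) = (p * cnj p - q * cnj q) * \<tau> / of_real J"
        unfolding v_def by (simp add: diff_divide_distrib add_divide_distrib algebra_simps)
      also have "p * cnj p - q * cnj q = of_real J"
        unfolding J_def of_real_diff complex_norm_square ..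
      finally show ?thesis using J by simp
    qed
    \<comment> \<open>The differential stretches every vector by at least |p| - |q|, so the preimage
      of a unit vector has length at most 1 / \<open>\<psi>' (norm y)\<close>.\<close>
    have nv: "\<psi>' (norm y) * norm v \<le> 1"
    proof -
      have "\<psi>' (norm y) * norm v \<le> (norm p - norm q) * norm v"
        using pq by (intro mult_right_mono) auto
      also have "\<dots> = norm (p * v) - norm (cnj (q * v))"
        by (simp add: norm_mult algebra_simps)
      also have "\<dots> \<le> norm (p * v + cnj (q * v))" by (rule norm_diff_ineq)
      finally show ?thesis using nt v by simp
    qed
    have dF: "(F has_derivative (\<lambda>v. p * v + cnj (q * v))) (at y)"
    proof -
      have "(h has_derivative (*) p) (at y)" "(g has_derivative (*) q) (at y)"
        using holomorphic_derivI[OF hg(1), of y] holomorphic_derivI[OF hg(2), of y] y1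
        by (auto simp: p_def q_def has_field_derivative_def)
      then show ?thesis unfolding F
        by (intro has_derivative_add bounded_linear.has_derivative[OF bounded_linear_cnj])
    qed
    have "\<tau> \<bullet> sgn (F y) = - 1"
      using nt unfolding \<tau>_def by (simp add: dot_square_norm)
    then have d1: "((\<lambda>t. norm (F (y + of_real t * v))) has_real_derivative - 1) (at 0)"
      using has_derivative_norm_line[OF dF Fy, of v] v by simp
    have d2: "((\<lambda>t. norm (y + of_real t * v)) has_real_derivative v \<bullet> sgn y) (at 0)"
      using has_derivative_norm_line[OF has_derivative_ident y0, of v] by simp
    have "((\<lambda>t. \<psi> (norm (y + of_real t * v))) has_real_derivative \<psi>' (norm y) * (v \<bullet> sgn y)) (at 0)"
      by (rule DERIV_chain2[OF _ d2]) (use \<psi>(1)[of "norm y"] y1 in simp)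
    then have dM: "((\<lambda>t. M (y + of_real t * v)) has_real_derivative - 1 - c * (\<psi>' (norm y) * (v \<bullet> sgn y))) (at 0)"
      unfolding M_def by (intro DERIV_diff DERIV_cmult d1)
    have "\<bar>v \<bullet> sgn y\<bar> \<le> norm v" using Cauchy_Schwarz_ineq2[of v "sgn y"] y0 by (simp add: norm_sgn)
    then have "\<bar>\<psi>' (norm y) * (v \<bullet> sgn y)\<bar> \<le> \<psi>' (norm y) * norm v"
      using pq by (simp add: abs_mult)
    then have "- 1 \<le> \<psi>' (norm y) * (v \<bullet> sgn y)" using nv by linarith
    then have "c * (- 1) \<le> c * (\<psi>' (norm y) * (v \<bullet> sgn y))" using c by (intro mult_left_mono) auto
    \<comment> \<open>Strictness comes from c < 1: |F| falls at rate 1, while c \<psi> falls at rate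
      at most c.\<close>
    then have neg: "- 1 - c * (\<psi>' (norm y) * (v \<bullet> sgn y)) < 0" using c by linarith
    obtain d where d: "d > 0" "\<And>t. 0 < t \<Longrightarrow> t < d \<Longrightarrow> M (y + of_real t * v) < M y"
      using DERIV_neg_dec_right[OF dM neg] by auto
    obtain e where e: "e > 0" "\<And>t. 0 < t \<Longrightarrow> t < e \<Longrightarrow> norm (F (y + of_real t * v)) < norm (F y)"
      using DERIV_neg_dec_right[OF d1] by auto
    define t where "t = min (min (d / 2) (e / 2)) ((r - norm y) / (norm v + 1))"
    have t: "0 < t" "t < d" "t < e" "t * (norm v + 1) \<le> r - norm y"
      using d e yr by (auto simp: t_def min_less_iff_disj pos_le_divide_eq[symmetric] add_nonneg_pos)
    have "norm (y + of_real t * v) \<le> norm y + t * norm v"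
      using norm_triangle_ineq[of y "of_real t * v"] t by (simp add: norm_mult)
    also have "\<dots> \<le> r" using t by (simp add: algebra_simps)
    finally have "y + of_real t * v \<in> K" using e(2)[OF t(1,3)] y(1) by (simp add: K_def)
    then show False using y(2) d(2)[OF t(1,2)] by (meson not_less)
  qed
  then have "M y = 0" by (simp add: M_def F0 \<psi>)
  then have "0 \<le> M z" using y(2)[OF \<open>z \<in> K\<close>] by (simp only:)
  then show ?thesis by (simp add: M_def)
qed

text \<open>The disk |w| < m misses the image of the circle, so it is covered by two disjoint open
  sets, the image of the open ball and the complement of the image of the closed one. It is
  connected and contains F 0 = 0, hence lies in the first.\<close>

lemma ball_subset_image_ball:
  fixes F :: "complex \<Rightarrow> complex"
  assumes cont: "continuous_on (cball 0 r) F" and inj: "inj_on F (cball 0 r)" and F0: "F 0 = 0"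
    and r: "0 < r" and m: "0 < m" "\<And>z. norm z = r \<Longrightarrow> m \<le> norm (F z)"
  shows "ball 0 m \<subseteq> F ` ball 0 r"
proof -
  have 1: "open (F ` ball 0 r)"
    by (intro invariance_of_domain continuous_on_subset[OF cont] inj_on_subset[OF inj]) auto
  have 2: "open (- F ` cball 0 r)"
    using compact_continuous_image[OF cont compact_cball] by (intro open_Compl compact_imp_closed)
  have 3: "ball 0 m \<subseteq> F ` ball 0 r \<union> - F ` cball 0 r"
  proof
    fix w :: complex assume w: "w \<in> ball 0 m"
    have "norm z \<noteq> r" if "w = F z" for z using m(2)[of z] w that by auto
    then show "w \<in> F ` ball 0 r \<union> - F ` cball 0 r" by force
  qed
  have 4: "F ` ball 0 r \<inter> - F ` cball 0 r \<inter> ball 0 m = {}" by force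
  have 5: "F ` ball 0 r \<inter> ball 0 m \<noteq> {}"
    using F0 r m(1) by (auto intro!: bexI[of _ 0] simp: disjoint_iff)
  have "- F ` cball 0 r \<inter> ball 0 m = {}"
    using connectedD[OF connected_ball 1 2 4 3] 5 by blast
  then show ?thesis using 3 by blast
qed

text \<open>Here m is the minimum of |F| on the circle, attained at \<open>z1\<close>. Since
  \<open>harmonic_growth_in_disc\<close> asks for |F z| < m, it is applied at the preimages of t
  F(z1) with t < 1, which exist because the disk |w| < m is covered. They tend to \<open>z1\<close>
  as t tends to 1; the factor c < 1 is removed last.\<close>

lemma harmonic_growth:
  fixes F h g :: "complex \<Rightarrow> complex" and \<psi> \<psi>' :: "real \<Rightarrow> real"
  assumes hg: "h holomorphic_on ball 0 1" "g holomorphic_on ball 0 1"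
    and F: "F = (\<lambda>z. h z + cnj (g z))" and inj: "inj_on F (ball 0 1)" and F0: "F 0 = 0"
    and \<psi>: "\<And>t. 0 \<le> t \<Longrightarrow> t < 1 \<Longrightarrow> (\<psi> has_real_derivative \<psi>' t) (at t)" "\<psi> 0 = 0"
    and \<psi>'_pos: "\<And>t. 0 \<le> t \<Longrightarrow> t < 1 \<Longrightarrow> 0 < \<psi>' t"
    and le: "\<And>z. norm z < 1 \<Longrightarrow> \<psi>' (norm z) \<le> norm (deriv h z) - norm (deriv g z)"
    and r: "0 < r" "r < 1"
  obtains m where "\<psi> r \<le> m" "\<And>z. norm z = r \<Longrightarrow> m \<le> norm (F z)" "ball 0 m \<subseteq> F ` ball 0 r"
proof -
  have contF: "continuous_on (cball 0 r) F"
    unfolding F by (intro continuous_intros holomorphic_on_imp_continuous_on holomorphic_on_subset[OF hg(1)]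
      holomorphic_on_subset[OF hg(2)]) (use r in auto)
  have injr: "inj_on F (cball 0 r)" by (rule inj_on_subset[OF inj]) (use r in auto)
  have "continuous_on (sphere 0 r) (\<lambda>z. norm (F z))"
    by (intro continuous_intros continuous_on_subset[OF contF]) auto
  then obtain z1 where z1: "z1 \<in> sphere 0 r" "\<And>z. z \<in> sphere 0 r \<Longrightarrow> norm (F z1) \<le> norm (F z)"
    using continuous_attains_inf[of "sphere 0 r" "\<lambda>z. norm (F z)"] r by auto
  define m where "m = norm (F z1)"
  have m: "m \<le> norm (F z)" if "norm z = r" for z using z1(2)[of z] that by (simp add: m_def)
  have "z1 \<noteq> 0" using z1(1) r by auto
  then have m0: "m > 0" using inj_onD[OF inj, of z1 0] F0 z1(1) r by (auto simp: m_def)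
  have sub: "ball 0 m \<subseteq> F ` ball 0 r"
    by (rule ball_subset_image_ball[OF contF injr F0 r(1) m0 m])
  have "\<psi> r \<le> m"
  proof (rule field_le_mult_one_interval)
    fix c :: real assume c: "0 < c" "c < 1"
    define Z where "Z = (\<lambda>t. inv_into (cball 0 r) F (of_real t * F z1))"
    have Z: "norm (Z t) < r" "F (Z t) = of_real t * F z1" if t: "0 < t" "t < 1" for t
    proof -
      have "norm (of_real t * F z1) < m" using t m0 by (simp add: norm_mult m_def)
      then obtain x where x: "x \<in> ball 0 r" "of_real t * F z1 = F x" using sub by force
      then have "Z t = x" unfolding Z_def using injr by (simp add: inv_into_f_f)
      then show "norm (Z t) < r" "F (Z t) = of_real t * F z1" using x by auto
    qed
    have Z1: "Z 1 = z1" unfolding Z_def using injr z1(1) by (simp add: inv_into_f_f)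
    \<comment> \<open>A continuous injection of a compact set has a continuous inverse, so the
      convergence of t F(z1) is carried back to \<open>Z t\<close>.\<close>
    have "continuous_on {0..1} Z"
    proof -
      have "continuous_on (F ` cball 0 r) (inv_into (cball 0 r) F)"
        by (rule continuous_on_inv[OF contF compact_cball]) (simp add: injr inv_into_f_f)
      moreover have "of_real t * F z1 \<in> F ` cball 0 r" if "t \<in> {0..1}" for t
      proof (cases "t = 0 \<or> t = 1")
        case True
        have "0 \<in> cball (0::complex) r" using r by simp
        then show ?thesis using True z1(1) F0 by (auto intro: rev_image_eqI)
      next
        case False
        then have "F (Z t) = of_real t * F z1" "norm (Z t) < r" using Z[of t] that by auto
        then show ?thesis by (metis image_eqI less_imp_le mem_cball_0)
      qed
      moreover have "continuous_on {0..1} (\<lambda>t. of_real t * F z1)"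
        by (intro continuous_intros)
      ultimately show ?thesis
        unfolding Z_def using continuous_on_compose2[of "F ` cball 0 r" "inv_into (cball 0 r) F"] by blast
    qed
    then have "(Z \<longlongrightarrow> Z 1) (at 1 within {0..1})"
      unfolding continuous_on_def by (rule bspec) simp
    then have "(Z \<longlongrightarrow> z1) (at 1 within {0..1})" unfolding Z1 .
    then have "(Z \<longlongrightarrow> z1) (at_left 1)"
      by (simp add: at_within_Icc_at_left)
    then have "((\<lambda>t. norm (Z t)) \<longlongrightarrow> r) (at_left 1)" using z1(1) tendsto_norm[of Z z1] by simp
    moreover have "isCont \<psi> r" using \<psi>(1)[of r] r DERIV_isCont by auto
    ultimately have "((\<lambda>t. c * \<psi> (norm (Z t))) \<longlongrightarrow> c * \<psi> r) (at_left 1)"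
      by (rule tendsto_mult_left[OF isCont_tendsto_compose[rotated]])
    moreover have "\<forall>\<^sub>F t in at_left 1. c * \<psi> (norm (Z t)) \<le> m"
      using eventually_at_left_real[OF zero_less_one]
    proof eventually_elim
      case (elim t)
      have "norm (F (Z t)) = t * m" using Z(2)[of t] elim by (simp add: norm_mult m_def)
      then have n: "norm (F (Z t)) < m" using elim m0 by simp
      then have "c * \<psi> (norm (Z t)) \<le> norm (F (Z t))"
        using Z(1)[of t] elim by (intro harmonic_growth_in_disc[OF hg F inj F0 \<psi> \<psi>'_pos le r(2) m c]) auto
      then show ?case using n by simp
    qed
    ultimately show "c * \<psi> r \<le> m" by (intro tendsto_upperbound[of _ _ "at_left 1"]) auto
  qed
  then show ?thesis using that m sub by blast
qed

subsection \<open>Harmonic maps with univalent shear\<close>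

text \<open>The difference of the analytic parts is a holomorphic function that is also the
  conjugate of one. Its differential is complex linear and conjugate linear, so comparing it at 1
  and \<i> shows that it vanishes; the normalization at 0 fixes the constant.\<close>

lemma harmonic_decomp_unique:
  assumes "harmonic_decomp f h g" "harmonic_decomp f h' g'" "norm z < 1"
  shows "h z = h' z" "g z = g' z"
proof -
  define A where "A = (\<lambda>z. h z - h' z)"
  define B where "B = (\<lambda>z. g' z - g z)"
  have hol: "A holomorphic_on ball 0 1" "B holomorphic_on ball 0 1"
    using assms unfolding A_def B_def harmonic_decomp_def by (auto intro!: holomorphic_intros)
  have AB: "A z = cnj (B z)" if "z \<in> ball 0 1" for z
  proof -
    have "h z + cnj (g z) = h' z + cnj (g' z)" using assms(1,2) that unfolding harmonic_decomp_def by metis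
    then show ?thesis by (simp add: A_def B_def algebra_simps)
  qed
  have d0: "deriv B z = 0" if z: "z \<in> ball 0 1" for z
  proof -
    have dA: "(A has_derivative (\<lambda>v. deriv A z * v)) (at z)"
      and "(B has_derivative (\<lambda>v. deriv B z * v)) (at z)"
      using holomorphic_derivI[OF hol(1) open_ball z] holomorphic_derivI[OF hol(2) open_ball z]
      by (auto simp: has_field_derivative_def)
    then have "((\<lambda>z. cnj (B z)) has_derivative (\<lambda>v. cnj (deriv B z * v))) (at z)"
      by (intro bounded_linear.has_derivative[OF bounded_linear_cnj])
    then have "(A has_derivative (\<lambda>v. cnj (deriv B z * v))) (at z)"
      by (rule has_derivative_transform_within_open[of _ _ _ _ "ball 0 1"]) (use z AB in auto)
    then have "(\<lambda>v. deriv A z * v) = (\<lambda>v. cnj (deriv B z * v))"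
      using dA has_derivative_unique by blast
    from fun_cong[OF this, of 1] fun_cong[OF this, of \<i>] show ?thesis
      by (auto simp: complex_eq_iff)
  qed
  have "B z = B 0"
  proof (rule has_field_derivative_zero_constant[THEN exE, of "ball 0 1" B])
    show "(B has_field_derivative 0) (at x within ball 0 1)" if "x \<in> ball 0 1" for x
      using holomorphic_derivI[OF hol(2) open_ball that] d0[OF that] has_field_derivative_at_within by metis
  qed (use assms(3) in auto)
  then have "B z = 0" using assms(1,2) by (simp add: B_def harmonic_decomp_def)
  then show "h z = h' z" "g z = g' z" using AB[of z] assms(3) by (simp_all add: A_def B_def)
qed

text \<open>The definitions assert sense preservation, \<open>deriv g 0 = 0\<close> and the
  univalent shear for possibly different pairs. Uniqueness on the open disk makes the derivatives
  agree there, so that one pair carries all three.\<close>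

lemma class_SH0_S_decomp:
  assumes "f \<in> class_SH0_S"
  obtains h g \<theta> where "harmonic_decomp f h g" "inj_on f (ball 0 1)" "deriv g 0 = 0"
    "\<And>z. norm z < 1 \<Longrightarrow> norm (deriv g z) < norm (deriv h z)"
    "(\<lambda>z. h z + exp (\<i> * of_real \<theta>) * g z) \<in> class_S"
proof -
  obtain h g and \<theta> :: real where hg: "harmonic_decomp f h g"
    "(\<lambda>z. h z + exp (\<i> * of_real \<theta>) * g z) \<in> class_S"
    using assms unfolding class_SH0_S_def by blast
  obtain h1 g1 where 1: "harmonic_decomp f h1 g1" "deriv g1 0 = 0"
    using assms unfolding class_SH0_S_def class_SH0_def by blast
  obtain h2 g2 where 2: "harmonic_decomp f h2 g2" "\<forall>z\<in>ball 0 1. decomp_jacobian h2 g2 z > 0"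
    using assms unfolding class_SH0_S_def class_SH0_def class_SH_def sense_preserving_def by blast
  have deriv_eq: "deriv h' z = deriv h z" "deriv g' z = deriv g z"
    if "harmonic_decomp f h' g'" "norm z < 1" for h' g' z
  proof -
    have "eventually (\<lambda>w. w \<in> ball 0 1) (nhds z)" using that by (intro eventually_nhds_in_open) auto
    then show "deriv h' z = deriv h z" "deriv g' z = deriv g z"
      using harmonic_decomp_unique[OF that(1) hg(1)]
      by (auto intro!: deriv_cong_ev elim!: eventually_mono)
  qed
  have "norm (deriv g z) < norm (deriv h z)" if "norm z < 1" for z
  proof (rule power2_less_imp_less)
    show "(norm (deriv g z))\<^sup>2 < (norm (deriv h z))\<^sup>2"
      using bspec[OF 2(2), of z] that
      unfolding decomp_jacobian_def deriv_eq[OF 2(1) that] by simp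
  qed simp
  moreover have "inj_on f (ball 0 1)"
    using assms by (auto simp: class_SH0_S_def class_SH0_def class_SH_def)
  moreover have "deriv g 0 = 0" using deriv_eq(2)[OF 1(1), of 0] 1(2) by simp
  ultimately show ?thesis using that hg by blast
qed

text \<open>For every \<theta>, |h'| - |g'| <= |\<phi>'| <= |h'| + |g'|. From |g'| <= r |h'| follows
  (1 - r)(|h'| + |g'|) <= (1 + r)(|h'| - |g'|), which converts the Koebe bound for one combination
  into a bound for the other.\<close>

lemma shear_derivative_bounds:
  fixes h g :: "complex \<Rightarrow> complex"
  assumes hg: "h holomorphic_on ball 0 1" "g holomorphic_on ball 0 1" "deriv g 0 = 0"
    and less: "\<And>z. norm z < 1 \<Longrightarrow> norm (deriv g z) < norm (deriv h z)"
    and \<phi>: "(\<lambda>z. h z + exp (\<i> * of_real \<theta>) * g z) \<in> class_S"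
    and z: "norm z < 1"
  shows "norm (deriv h z) + norm (deriv g z) \<le> (1 + norm z)\<^sup>2 / (1 - norm z)^4"
    and "(1 - norm z)\<^sup>2 / (1 + norm z)^4 \<le> norm (deriv h z) - norm (deriv g z)"
proof -
  define e where "e = exp (\<i> * complex_of_real \<theta>)"
  have ne: "norm e = 1" by (simp add: e_def)
  let ?\<phi> = "\<lambda>z. h z + e * g z"
  have hnz: "deriv h z \<noteq> 0" if "norm z < 1" for z using less[OF that] by auto
  define \<omega> where "\<omega> = (\<lambda>z. deriv g z / deriv h z)"
  have w: "norm (\<omega> z) \<le> norm z"
  proof (rule Schwarz_Lemma(1)[OF _ _ _ z])
    show "\<omega> holomorphic_on ball 0 1" unfolding \<omega>_def using hnz
      by (intro holomorphic_intros holomorphic_deriv hg) auto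
    show "\<omega> 0 = 0" by (simp add: \<omega>_def hg)
    show "norm (\<omega> z) < 1" if "norm z < 1" for z
      using less[OF that] hnz[OF that] by (simp add: \<omega>_def norm_divide)
  qed
  define H G P r where "H = norm (deriv h z)" and "G = norm (deriv g z)" and "P = norm (deriv ?\<phi> z)" and "r = norm z"
  have r: "0 \<le> r" "r < 1" using z by (auto simp: r_def)
  have GH: "G \<le> r * H" using w hnz[OF z] by (simp add: \<omega>_def norm_divide H_def G_def r_def divide_le_eq)
  have "(?\<phi> has_field_derivative deriv h z + e * deriv g z) (at z)"
    using z by (intro DERIV_add DERIV_cmult holomorphic_derivI[OF hg(1)] holomorphic_derivI[OF hg(2)]) auto
  then have "deriv ?\<phi> z = deriv h z + e * deriv g z" by (rule DERIV_imp_deriv)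
  then have P: "H - G \<le> P" "P \<le> H + G"
    using norm_diff_ineq[of "deriv h z" "e * deriv g z"] norm_triangle_ineq[of "deriv h z" "e * deriv g z"] ne
    by (auto simp: P_def H_def G_def norm_mult)
  have koebe: "(1 - r) / (1 + r)^3 \<le> P" "P \<le> (1 + r) / (1 - r)^3"
    using koebe_distortion[OF \<phi> z] by (simp_all add: P_def r_def e_def)
  have "(1 - r) * (H + G) \<le> (1 + r) * (H - G)" using GH by (simp add: algebra_simps)
  also have "\<dots> \<le> (1 + r) * ((1 + r) / (1 - r)^3)" using P koebe r by (intro mult_left_mono) auto
  finally have "H + G \<le> (1 + r) * ((1 + r) / (1 - r)^3) / (1 - r)" using r by (metis mult.commute pos_le_divide_eq diff_gt_0_iff_gt)
  also have "\<dots> = (1 + r)\<^sup>2 / (1 - r)^4" by (simp add: power2_eq_square power_numeral_reduce)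
  finally show "norm (deriv h z) + norm (deriv g z) \<le> (1 + norm z)\<^sup>2 / (1 - norm z)^4"
    by (simp add: H_def G_def r_def)
  have "(1 - r) * ((1 - r) / (1 + r)^3) \<le> (1 - r) * (H + G)" using P koebe r by (intro mult_left_mono) auto
  also have "\<dots> \<le> (1 + r) * (H - G)" using GH by (simp add: algebra_simps)
  finally have "(1 - r) * ((1 - r) / (1 + r)^3) / (1 + r) \<le> H - G" using r by (metis mult.commute pos_divide_le_eq add_pos_nonneg zero_less_one)
  moreover have "(1 - r) * ((1 - r) / (1 + r)^3) / (1 + r) = (1 - r)\<^sup>2 / (1 + r)^4"
    by (simp add: power2_eq_square power_numeral_reduce)
  ultimately show "(1 - norm z)\<^sup>2 / (1 + norm z)^4 \<le> norm (deriv h z) - norm (deriv g z)"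
    by (simp add: H_def G_def r_def)
qed

text \<open>The Cayley quotient (1 + t)/(1 - t) has derivative 2/(1 - t)^2, and 1/6 cancels this 2
  together with the 3 from the cube.\<close>

lemma DERIV_upper_majorant:
  fixes t :: real assumes "0 \<le> t" "t < 1"
  shows "((\<lambda>t. 1/6 * (((1 + t) / (1 - t))^3 - 1)) has_real_derivative (1 + t)\<^sup>2 / (1 - t)^4) (at t)"
proof -
  have "((\<lambda>t. (1 + t) / (1 - t)) has_real_derivative 2 / (1 - t)\<^sup>2) (at t)"
    using assms by (auto intro!: derivative_eq_intros simp: power2_eq_square)
  from DERIV_cmult[OF DERIV_diff[OF DERIV_power[OF this, of 3] DERIV_const], of "1/6" 1]
  show ?thesis by (simp add: power_divide power2_eq_square power_numeral_reduce mult.assoc)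
qed

lemma DERIV_lower_minorant:
  fixes t :: real assumes "0 \<le> t" "t < 1"
  shows "((\<lambda>t. 1/6 * (1 - ((1 - t) / (1 + t))^3)) has_real_derivative (1 - t)\<^sup>2 / (1 + t)^4) (at t)"
proof -
  have "((\<lambda>t. (1 - t) / (1 + t)) has_real_derivative - 2 / (1 + t)\<^sup>2) (at t)"
    using assms by (auto intro!: derivative_eq_intros simp: power2_eq_square)
  from DERIV_cmult[OF DERIV_diff[OF DERIV_const DERIV_power[OF this, of 3]], of "1/6" 1]
  show ?thesis by (simp add: power_divide power2_eq_square power_numeral_reduce mult.assoc)
qed

lemma class_SH0_S_upper:
  assumes f: "f \<in> class_SH0_S" and z: "norm z < 1"
  shows "norm (f z) \<le> 1/6 * (((1 + norm z) / (1 - norm z))^3 - 1)"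
proof (cases "z = 0")
  case True
  then have "f z = 0" using f by (auto simp: class_SH0_S_def harmonic_decomp_def)
  then show ?thesis using True by simp
next
  case False
  obtain h g \<theta> where hg: "harmonic_decomp f h g" "inj_on f (ball 0 1)" "deriv g 0 = 0"
    "\<And>z. norm z < 1 \<Longrightarrow> norm (deriv g z) < norm (deriv h z)"
    "(\<lambda>z. h z + exp (\<i> * of_real \<theta>) * g z) \<in> class_S"
    by (rule class_SH0_S_decomp[OF f]) (rule that)
  have hol: "h holomorphic_on ball 0 1" "g holomorphic_on ball 0 1"
    using hg(1) by (auto simp: harmonic_decomp_def)
  define r where "r = norm z"
  define u where "u = z / of_real r"
  have r: "0 < r" "r < 1" and u: "norm u = 1" "z = of_real r * u"
    using False z by (auto simp: r_def u_def norm_divide)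
  define \<Phi> where "\<Phi> = (\<lambda>t::real. 1/6 * (((1 + t) / (1 - t))^3 - 1))"
  have d\<Phi>: "(\<Phi> has_real_derivative (1 + t)\<^sup>2 / (1 - t)^4) (at t)" if "0 \<le> t" "t < 1" for t
    unfolding \<Phi>_def by (rule DERIV_upper_majorant[OF that])
  let ?F = "\<lambda>t. h (of_real t * u) + cnj (g (of_real t * u))"
  have dF: "(?F has_vector_derivative u * deriv h (of_real t * u) + cnj (u * deriv g (of_real t * u))) (at t)"
    if t: "0 \<le> t" "t < 1" for t
  proof -
    have b: "of_real t * u \<in> ball 0 1" using t u by (simp add: norm_mult)
    have l: "((\<lambda>t. of_real t * u) has_vector_derivative u) (at t)"
      by (auto intro!: derivative_eq_intros simp: has_vector_derivative_def scaleR_conv_of_real)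
    show ?thesis
      using field_vector_diff_chain_at[OF l holomorphic_derivI[OF hol(1) open_ball b]]
        field_vector_diff_chain_at[OF l holomorphic_derivI[OF hol(2) open_ball b]]
      by (intro has_vector_derivative_add has_vector_derivative_cnj) (simp_all add: o_def)
  qed
  have "norm (?F r - ?F 0) \<le> \<Phi> r - \<Phi> 0"
  \<comment> \<open>Mean value inequality for curves: the speed of \<open>?F\<close> is at most |h'|
    + |g'|, which the derivative of \<open>\<Phi>\<close> dominates.\<close>
  proof (rule differentiable_bound_general[OF r(1)])
    show "continuous_on {0..r} ?F"
      using r by (intro continuous_at_imp_continuous_on ballI has_vector_derivative_continuous[OF dF]) auto
    show "continuous_on {0..r} \<Phi>"
      using r by (intro continuous_at_imp_continuous_on ballI DERIV_isCont[OF d\<Phi>]) auto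
    fix t assume t: "0 < t" "t < r"
    show "(?F has_vector_derivative u * deriv h (of_real t * u) + cnj (u * deriv g (of_real t * u))) (at t)"
      using dF t r by simp
    show "(\<Phi> has_vector_derivative (1 + t)\<^sup>2 / (1 - t)^4) (at t)"
      using d\<Phi>[of t] t r by (simp add: has_real_derivative_iff_has_vector_derivative)
    have n: "norm (of_real t * u) = t" using t u by (simp add: norm_mult)
    have "norm (u * deriv h (of_real t * u) + cnj (u * deriv g (of_real t * u)))
        \<le> norm (deriv h (of_real t * u)) + norm (deriv g (of_real t * u))"
      using norm_triangle_ineq[of "u * deriv h (of_real t * u)" "cnj (u * deriv g (of_real t * u))"] u
      by (simp add: norm_mult)
    also have "\<dots> \<le> (1 + t)\<^sup>2 / (1 - t)^4"
      using shear_derivative_bounds(1)[OF hol hg(3-5), of "of_real t * u"] n t r by simp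
    finally show "norm (u * deriv h (of_real t * u) + cnj (u * deriv g (of_real t * u))) \<le> (1 + t)\<^sup>2 / (1 - t)^4" .
  qed
  moreover have "?F r = f z" "?F 0 = 0" "\<Phi> 0 = 0"
    using hg(1) z u by (auto simp: harmonic_decomp_def \<Phi>_def)
  ultimately show ?thesis by (simp add: \<Phi>_def r_def)
qed

text \<open>A single m serves both uses: it bounds |f| from below on the circle, and it is the
  radius of a disk covered by the image, which tends to include |w| < 1/6 as r tends to 1.\<close>

lemma class_SH0_S_lower:
  assumes f: "f \<in> class_SH0_S" and r: "0 < r" "r < 1"
  obtains m where "1/6 * (1 - ((1 - r) / (1 + r))^3) \<le> m"
    "\<And>z. norm z = r \<Longrightarrow> m \<le> norm (f z)" "ball 0 m \<subseteq> f ` ball 0 r"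
proof -
  obtain h g \<theta> where hg: "harmonic_decomp f h g" "inj_on f (ball 0 1)" "deriv g 0 = 0"
    "\<And>z. norm z < 1 \<Longrightarrow> norm (deriv g z) < norm (deriv h z)"
    "(\<lambda>z. h z + exp (\<i> * of_real \<theta>) * g z) \<in> class_S"
    by (rule class_SH0_S_decomp[OF f]) (rule that)
  have hol: "h holomorphic_on ball 0 1" "g holomorphic_on ball 0 1" "h 0 = 0" "g 0 = 0"
    using hg(1) by (auto simp: harmonic_decomp_def)
  \<comment> \<open>\<open>f\<close> is known to equal this sum only on the disk, while
    \<open>harmonic_growth\<close> takes a function given by the formula everywhere.\<close>
  define F where "F = (\<lambda>z. h z + cnj (g z))"
  have F: "F z = f z" if "norm z < 1" for z using hg(1) that by (simp add: harmonic_decomp_def F_def)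
  have injF: "inj_on F (ball 0 1)" using hg(2) by (rule inj_on_cong[THEN iffD2, rotated]) (simp add: F)
  show ?thesis
  proof (rule harmonic_growth[OF hol(1,2) F_def injF _ DERIV_lower_minorant _ _ _ r])
    show "(1 - norm z)\<^sup>2 / (1 + norm z)^4 \<le> norm (deriv h z) - norm (deriv g z)" if "norm z < 1" for z
      by (rule shear_derivative_bounds(2)[OF hol(1,2) hg(3-5) that])
    fix m assume m: "1/6 * (1 - ((1 - r) / (1 + r))^3) \<le> m" "\<And>z. norm z = r \<Longrightarrow> m \<le> norm (F z)"
      "ball 0 m \<subseteq> F ` ball 0 r"
    have "F ` ball 0 r = f ` ball 0 r" using r by (intro image_cong) (auto simp: F)
    then show thesis using that[OF m(1)] m(2,3) F r by auto
  qed (auto simp: F_def hol)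
qed

theorem theorem2:
  "(\<forall>f\<in>class_SH0_S. \<forall>z\<in>unit_disk. \<forall>r. r = norm z \<longrightarrow>
      1/6 * (1 - ((1 - r) / (1 + r))^3) \<le> norm (f z) \<and>
      norm (f z) \<le> 1/6 * (((1 + r) / (1 - r))^3 - 1)) \<and>
   (\<forall>f\<in>class_SH0_S. ball 0 (1/6) \<subseteq> f ` unit_disk) \<and>
   (\<forall>F \<in> {harmonic_koebe} \<union> {rotation \<alpha> harmonic_koebe |\<alpha>. True}.
      F \<in> class_SH0_S \<and>
      (\<forall>r::real. 0 \<le> r \<and> r < 1 \<longrightarrow>
         (\<exists>z. norm z = r \<and> norm (F z) = 1/6 * (1 - ((1 - r) / (1 + r))^3)) \<and>
         (\<exists>z. norm z = r \<and> norm (F z) = 1/6 * (((1 + r) / (1 - r))^3 - 1))))"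
proof (intro conjI ballI allI impI)
  fix f z r assume f: "f \<in> class_SH0_S" and z: "z \<in> ball (0::complex) 1" and r: "r = norm z"
  show "norm (f z) \<le> 1/6 * (((1 + r) / (1 - r))^3 - 1)"
    using class_SH0_S_upper[OF f, of z] z r by simp
  show "1/6 * (1 - ((1 - r) / (1 + r))^3) \<le> norm (f z)"
  proof (cases "z = 0")
    case False
    then have "0 < r" "r < 1" using z r by auto
    from class_SH0_S_lower[OF f this] r show ?thesis by (metis order.trans)
  qed (simp add: r)
next
  fix f assume f: "f \<in> class_SH0_S"
  show "ball 0 (1/6) \<subseteq> f ` ball 0 1"
  proof
    fix w :: complex assume w: "w \<in> ball 0 (1/6)"
    \<comment> \<open>Since the lower bound tends to 1/6, it exceeds |w| for some r < 1, and the
      disk covered by the image of that smaller ball then contains w.\<close>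
    have "((\<lambda>r. 1/6 * (1 - ((1 - r) / (1 + r))^3)) \<longlongrightarrow> (1/6 :: real)) (at_left 1)"
      by (auto intro!: tendsto_eq_intros)
    then have "\<forall>\<^sub>F r in at_left 1. norm w < 1/6 * (1 - ((1 - r) / (1 + r))^3)"
      using w by (intro order_tendstoD(1)) auto
    moreover have "\<forall>\<^sub>F r in at_left 1. r \<in> {0<..<1::real}" by (rule eventually_at_left_real) simp
    ultimately have "\<forall>\<^sub>F r in at_left (1::real). w \<in> f ` ball 0 1"
    proof eventually_elim
      case (elim r)
      then have r: "0 < r" "r < 1" by auto
      obtain m where "1/6 * (1 - ((1 - r) / (1 + r))^3) \<le> m" "ball 0 m \<subseteq> f ` ball 0 r"
        using class_SH0_S_lower[OF f r] by metis
      then have "w \<in> f ` ball 0 r" using elim(1) by auto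
      then show ?case using r by auto
    qed
    then show "w \<in> f ` ball 0 1" by simp
  qed
next
  fix F assume "F \<in> {harmonic_koebe} \<union> {rotation \<alpha> harmonic_koebe |\<alpha>. True}"
  moreover have "harmonic_koebe = rotation 0 harmonic_koebe" by (simp add: rotation_def fun_eq_iff)
  ultimately obtain \<alpha> where F: "F = rotation \<alpha> harmonic_koebe" by blast
  show "F \<in> class_SH0_S" unfolding F by (rule rotation_harmonic_koebe_in_class)
  fix r :: real assume "0 \<le> r \<and> r < 1"
  then show "\<exists>z. norm z = r \<and> norm (F z) = 1/6 * (1 - ((1 - r) / (1 + r))^3)"
    "\<exists>z. norm z = r \<and> norm (F z) = 1/6 * (((1 + r) / (1 - r))^3 - 1)"
    unfolding F using norm_rotation_harmonic_koebe by blast+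
qed

end
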